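(* Let $a_1,\dots,a_n\in\mathbb{C}$ be pairwise distinct, let $\alpha_1,\dots,\alpha_n$ be nonzero real numbers with $\alpha=\sum_{i=1}^n\alpha_i>0$, let $$\varpi(z)=-\left(\sum_{i=1}^{n}\frac{\alpha_i}{z-a_i}\right)^2dz^2$$ on $\widehat{\mathbb{C}}$, and let $p$ be the polynomial defined by $\sum_{i=1}^n\frac{\alpha_i}{z-a_i}=\frac{p(z)}{\prod_{i=1}^n(z-a_i)}$. Let $\mathcal{U}$ be a Ring Domain of $\varpi$ bounded by two sub-lemniscates $\Gamma_r$ and $\Gamma_R$, of levels $r$ and $R$, normalized so that $0<r<1<R$. Suppose that, for some $1<s<n$, the points $a_1,\dots,a_s$ are in the bounded domain of $\mathbb{C}$ with boundary $\Gamma_r$, the other points $a_{s+1},\dots,a_n$ lying in the unbounded component of the complement of $\mathcal{U}$. Let $\Gamma_1$ be the sub-lemniscate of $\varpi$ of level $1$ in $\mathcal{U}$, with associated conformal maps $\phi_-,\phi_+$, and suppose that the bounded component $D_-$ of $\widehat{\mathbb{C}}\setminus\Gamma_1$ contains exactly two different zeros $a$ and $b$ of $p$, with respective multiplicities $\mu$ and $\nu$. Then the fingerprint $k:S^1\to S^1$ of $\Gamma_1$ satisfies, for some real number $\theta$, the functional equation $$(B\circ k)(z)=e^{i\theta}A(z),\qquad |z|=1,$$ where $$B(z)=z^{\alpha}\prod_{i=s+1}^{n}\left(\frac{z-\phi_+^{-1}(a_i)}{1-\overline{\phi_+^{-1}(a_i)}\,z}\right)^{\alpha_i},\qquad A(z)=\prod_{i=1}^{s}\left(\frac{z-\phi_-^{-1}(a_i)}{1-\overline{\phi_-^{-1}(a_i)}\,z}\right)^{\alpha_i}.$$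 Here the real powers are understood as continuous determinations along $S^1$.
   Context: The poles of $\varpi$ are $\infty,a_1,\dots,a_n$ (its infinite critical points); its zeros are its finite critical points. A (horizontal) trajectory of $\varpi$ is a maximal curve along which $\varpi(z)>0$; equivalently, along it $\prod_{i=1}^n|z-a_i|^{\alpha_i}$ is constant. A critical trajectory is one passing through a critical point, and the critical graph $\Gamma$ is the closure of the set of critical trajectories. The connected components of $\widehat{\mathbb{C}}\setminus\Gamma$ (with the double poles filled in) are the configuration domains of $\varpi$. A Ring Domain is a configuration domain swept by closed trajectories, conformally equivalent to an annulus, whose boundary consists of two connected components. For $\lambda>0$ the lemniscate of level $\lambda$ is $\{z\in\mathbb{C}:\prod_{i=1}^n|z-a_i|^{\alpha_i}=\lambda\}$. A sub-lemniscate of $\varpi$ is a connected component of such a lemniscate. A sub-lemniscate lying inside a Ring Domain is a $C^\infty$ Jordan curve. Fingerprint: let $\Delta$ be the open unit disk and $S^1=\partial\Delta$. For a $C^\infty$ Jordan curve $\gamma\subset\mathbb{C}$, let $D_-$ and $D_+$ be the bounded and unbounded components of $\widehat{\mathbb{C}}\setminus\gamma$. Let $\phi_-:\Delta\to D_-$ and $\phi_+:\widehat{\mathbb{C}}\setminus\overline{\Delta}\to D_+$ be conformal maps (bijections), $\phi_+$ being uniquely determined by the normalization $\phi_+(\infty)=\infty$, $\phi_+'(\infty)>0$ (i.e. $\phi_+(z)/z\to b_0>0$ as $z\to\infty$). Both extend to $C^\infty$ diffeomorphisms of the closures. The fingerprint of $\gamma$ is $k=\phi_+^{-1}\circ\phi_-:S^1\to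 S^1$; it is uniquely determined up to composition with an automorphism of $\Delta$. *)

theory Defs
  imports "HOL-Analysis.Analysis" "HOL-Complex_Analysis.Complex_Analysis"
begin

section \<open>The quadratic differential and its trajectories\<close>

definition log_deriv :: "nat \<Rightarrow> (nat \<Rightarrow> complex) \<Rightarrow> (nat \<Rightarrow> real) \<Rightarrow> complex \<Rightarrow> complex" where
  "log_deriv n a \<alpha> z = (\<Sum>i=1..n. of_real (\<alpha> i) / (z - a i))"

text \<open>The coefficient of \<open>dz\<^sup>2\<close>; its value at the poles \<open>a i\<close> is meaningless and never used.\<close>

definition quad_diff :: "nat \<Rightarrow> (nat \<Rightarrow> complex) \<Rightarrow> (nat \<Rightarrow> real) \<Rightarrow> complex \<Rightarrow> complex" where
  "quad_diff n a \<alpha> z = - (log_deriv n a \<alpha> z)\<^sup>2"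

text \<open>The one-point compactification of the plane; \<open>None\<close> is the point at infinity.\<close>

abbreviation riemann_sphere :: "complex option topology" where
  "riemann_sphere \<equiv> Alexandroff_compactification euclidean"

definition critical_points :: "nat \<Rightarrow> (nat \<Rightarrow> complex) \<Rightarrow> (nat \<Rightarrow> real) \<Rightarrow> complex option set" where
  "critical_points n a \<alpha> =
     insert None (Some ` (a ` {1..n})) \<union>
     Some ` {z. z \<notin> a ` {1..n} \<and> quad_diff n a \<alpha> z = 0}"

text \<open>Horizontal curves are parametrized over the open unit interval, which is no restriction:
  any open parameter interval can be rescaled to it.\<close>

definition horizontal_curve ::
    "nat \<Rightarrow> (nat \<Rightarrow> complex) \<Rightarrow> (nat \<Rightarrow> real) \<Rightarrow> (real \<Rightarrow> complex) \<Rightarrow> bool" where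
  "horizontal_curve n a \<alpha> \<gamma> \<longleftrightarrow>
     \<gamma> C1_differentiable_on {0<..<1} \<and>
     (\<forall>t\<in>{0<..<1}. \<gamma> t \<notin> a ` {1..n} \<and>
        quad_diff n a \<alpha> (\<gamma> t) * (vector_derivative \<gamma> (at t))\<^sup>2 \<in> complex_of_real ` {0<..})"

text \<open>A trajectory is identified with the point set it traces out; maximality refers to that set.
  A closed trajectory is traced out by a periodic (hence repeatedly winding) curve.\<close>

definition trajectory ::
    "nat \<Rightarrow> (nat \<Rightarrow> complex) \<Rightarrow> (nat \<Rightarrow> real) \<Rightarrow> complex set \<Rightarrow> bool" where
  "trajectory n a \<alpha> T \<longleftrightarrow>
     (\<exists>\<gamma>. horizontal_curve n a \<alpha> \<gamma> \<and> T = \<gamma> ` {0<..<1}) \<and>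
     (\<forall>\<delta>. horizontal_curve n a \<alpha> \<delta> \<and> T \<subseteq> \<delta> ` {0<..<1} \<longrightarrow> \<delta> ` {0<..<1} = T)"

definition closed_trajectory ::
    "nat \<Rightarrow> (nat \<Rightarrow> complex) \<Rightarrow> (nat \<Rightarrow> real) \<Rightarrow> complex set \<Rightarrow> bool" where
  "closed_trajectory n a \<alpha> T \<longleftrightarrow>
     trajectory n a \<alpha> T \<and> (\<exists>g. simple_path g \<and> pathfinish g = pathstart g \<and> path_image g = T)"

text \<open>Since the differential does not take positive values at a critical point, a trajectory passes
  through such a point in the sense that one of its ends tends to it.\<close>

definition critical_trajectory ::
    "nat \<Rightarrow> (nat \<Rightarrow> complex) \<Rightarrow> (nat \<Rightarrow> real) \<Rightarrow> complex set \<Rightarrow> bool" where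
  "critical_trajectory n a \<alpha> T \<longleftrightarrow>
     trajectory n a \<alpha> T \<and>
     (\<exists>\<gamma> c. horizontal_curve n a \<alpha> \<gamma> \<and> \<gamma> ` {0<..<1} = T \<and> c \<in> critical_points n a \<alpha> \<and>
        (limitin riemann_sphere (\<lambda>t. Some (\<gamma> t)) c (at_right 0) \<or>
         limitin riemann_sphere (\<lambda>t. Some (\<gamma> t)) c (at_left 1)))"

definition critical_graph ::
    "nat \<Rightarrow> (nat \<Rightarrow> complex) \<Rightarrow> (nat \<Rightarrow> real) \<Rightarrow> complex option set" where
  "critical_graph n a \<alpha> =
     riemann_sphere closure_of (Some ` \<Union>{T. critical_trajectory n a \<alpha> T})"

text \<open>The double poles belong to the complement of the critical graph in the sphere, so the
  components of that complement already have their poles filled in.\<close>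

definition configuration_domain ::
    "nat \<Rightarrow> (nat \<Rightarrow> complex) \<Rightarrow> (nat \<Rightarrow> real) \<Rightarrow> complex option set \<Rightarrow> bool" where
  "configuration_domain n a \<alpha> D \<longleftrightarrow>
     D \<in> connected_components_of
           (subtopology riemann_sphere (topspace riemann_sphere - critical_graph n a \<alpha>))"

text \<open>The point at infinity is a pole, so a domain swept by trajectories lies in the plane.\<close>

definition ring_domain ::
    "nat \<Rightarrow> (nat \<Rightarrow> complex) \<Rightarrow> (nat \<Rightarrow> real) \<Rightarrow> complex set \<Rightarrow> bool" where
  "ring_domain n a \<alpha> U \<longleftrightarrow>
     configuration_domain n a \<alpha> (Some ` U) \<and>
     U = \<Union>{T. closed_trajectory n a \<alpha> T \<and> T \<subseteq> U} \<and>
     (\<exists>\<rho>\<^sub>1 \<rho>\<^sub>2 h. 0 < \<rho>\<^sub>1 \<and> \<rho>\<^sub>1 < \<rho>\<^sub>2 \<and>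
        h holomorphic_on {w. \<rho>\<^sub>1 < norm w \<and> norm w < \<rho>\<^sub>2} \<and>
        bij_betw h {w. \<rho>\<^sub>1 < norm w \<and> norm w < \<rho>\<^sub>2} U) \<and>
     card (components (frontier U)) = 2"

section \<open>Lemniscates\<close>

text \<open>As \<open>0 powr x = 0\<close>, the product vanishes at every \<open>a i\<close>, also for negative exponents, so no
  \<open>a i\<close> lies on a lemniscate of positive level.\<close>

definition lemniscate ::
    "nat \<Rightarrow> (nat \<Rightarrow> complex) \<Rightarrow> (nat \<Rightarrow> real) \<Rightarrow> real \<Rightarrow> complex set" where
  "lemniscate n a \<alpha> l = {z. (\<Prod>i=1..n. norm (z - a i) powr \<alpha> i) = l}"

definition sub_lemniscate ::
    "nat \<Rightarrow> (nat \<Rightarrow> complex) \<Rightarrow> (nat \<Rightarrow> real) \<Rightarrow> real \<Rightarrow> complex set \<Rightarrow> bool" where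
  "sub_lemniscate n a \<alpha> l C \<longleftrightarrow> 0 < l \<and> C \<in> components (lemniscate n a \<alpha> l)"

text \<open>The sub-lemniscates \<open>\<Gamma>r\<close> and \<open>\<Gamma>R\<close> bound the ring domain \<open>U\<close> from inside and outside.
  Inclusion rather than equality: a sub-lemniscate at a critical level has several loops, only some
  of which border on \<open>U\<close> (e.g. \<open>U\<close> fills a neighbourhood of one loop of a figure eight from inside).\<close>

definition bounded_by ::
    "complex set \<Rightarrow> complex set \<Rightarrow> complex set \<Rightarrow> bool" where
  "bounded_by U \<Gamma>r \<Gamma>R \<longleftrightarrow> frontier (inside U) \<subseteq> \<Gamma>r \<and> frontier (outside U) \<subseteq> \<Gamma>R"

section \<open>Fingerprints\<close>

text \<open>Both maps denote the conformal maps together with their extension to the boundary circle; only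
  the homeomorphic (not the smooth) extension is demanded. For a Jordan curve \<open>\<Gamma>\<close>, \<open>inside \<Gamma>\<close> and
  \<open>outside \<Gamma>\<close> are its bounded component and its unbounded component without infinity.\<close>

definition interior_map :: "complex set \<Rightarrow> (complex \<Rightarrow> complex) \<Rightarrow> bool" where
  "interior_map \<Gamma> \<phi> \<longleftrightarrow>
     \<phi> holomorphic_on ball 0 1 \<and> bij_betw \<phi> (ball 0 1) (inside \<Gamma>) \<and>
     (\<exists>\<psi>. homeomorphism (cball 0 1) (closure (inside \<Gamma>)) \<phi> \<psi>)"

text \<open>The limit condition expresses \<open>\<phi>(\<infinity>) = \<infinity>\<close> and \<open>\<phi>'(\<infinity>) > 0\<close>.\<close>

definition exterior_map :: "complex set \<Rightarrow> (complex \<Rightarrow> complex) \<Rightarrow> bool" where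
  "exterior_map \<Gamma> \<phi> \<longleftrightarrow>
     \<phi> holomorphic_on {z. 1 < norm z} \<and> bij_betw \<phi> {z. 1 < norm z} (outside \<Gamma>) \<and>
     (\<exists>\<psi>. homeomorphism {z. 1 \<le> norm z} (closure (outside \<Gamma>)) \<phi> \<psi>) \<and>
     (\<exists>b\<^sub>0>0. ((\<lambda>z. \<phi> z / z) \<longlongrightarrow> complex_of_real b\<^sub>0) at_infinity)"

definition int_inv :: "(complex \<Rightarrow> complex) \<Rightarrow> complex \<Rightarrow> complex" where
  "int_inv \<phi> = inv_into (cball 0 1) \<phi>"

definition ext_inv :: "(complex \<Rightarrow> complex) \<Rightarrow> complex \<Rightarrow> complex" where
  "ext_inv \<phi> = inv_into {z. 1 \<le> norm z} \<phi>"

definition fingerprint ::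
    "(complex \<Rightarrow> complex) \<Rightarrow> (complex \<Rightarrow> complex) \<Rightarrow> complex \<Rightarrow> complex" where
  "fingerprint \<phi>m \<phi>p z = ext_inv \<phi>p (\<phi>m z)"

section \<open>Continuous determinations of real powers along the circle\<close>

text \<open>\<open>h\<close> is a continuous determination of \<open>f\<^sup>\<beta>\<close> along the real line. A point moving along the unit
  circle is written \<open>cis t\<close>; in general the determinations are not periodic in \<open>t\<close>.\<close>

definition power_det :: "real \<Rightarrow> (real \<Rightarrow> complex) \<Rightarrow> (real \<Rightarrow> complex) \<Rightarrow> bool" where
  "power_det \<beta> f h \<longleftrightarrow>
     (\<exists>L. continuous_on UNIV L \<and> (\<forall>t. exp (L t) = f t) \<and> (\<forall>t. h t = exp (of_real \<beta> * L t)))"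

definition blaschke_factor :: "complex \<Rightarrow> complex \<Rightarrow> complex" where
  "blaschke_factor c z = (z - c) / (1 - cnj c * z)"

definition blaschke_det ::
    "nat set \<Rightarrow> (nat \<Rightarrow> real) \<Rightarrow> (nat \<Rightarrow> complex) \<Rightarrow> (real \<Rightarrow> complex) \<Rightarrow> (real \<Rightarrow> complex) \<Rightarrow> bool" where
  "blaschke_det I \<beta> c f H \<longleftrightarrow>
     (\<exists>h. (\<forall>i\<in>I. power_det (\<beta> i) (\<lambda>t. blaschke_factor (c i) (f t)) (h i)) \<and>
          H = (\<lambda>t. \<Prod>i\<in>I. h i t))"

text \<open>\<open>A_det \<dots> f H\<close> and \<open>B_det \<dots> f H\<close>: \<open>H\<close> is a continuous determination of \<open>A \<circ> f\<close>,
  respectively \<open>B \<circ> f\<close>, for a curve \<open>f\<close> in the unit circle.\<close>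

definition A_det :: "nat \<Rightarrow> (nat \<Rightarrow> complex) \<Rightarrow> (nat \<Rightarrow> real) \<Rightarrow> (complex \<Rightarrow> complex) \<Rightarrow>
    (real \<Rightarrow> complex) \<Rightarrow> (real \<Rightarrow> complex) \<Rightarrow> bool" where
  "A_det s a \<alpha> \<phi>m f H \<longleftrightarrow> blaschke_det {1..s} \<alpha> (\<lambda>i. int_inv \<phi>m (a i)) f H"

definition B_det :: "nat \<Rightarrow> nat \<Rightarrow> (nat \<Rightarrow> complex) \<Rightarrow> (nat \<Rightarrow> real) \<Rightarrow> (complex \<Rightarrow> complex) \<Rightarrow>
    (real \<Rightarrow> complex) \<Rightarrow> (real \<Rightarrow> complex) \<Rightarrow> bool" where
  "B_det n s a \<alpha> \<phi>p f H \<longleftrightarrow>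
     (\<exists>h\<^sub>0 h. power_det (\<Sum>i=1..n. \<alpha> i) f h\<^sub>0 \<and>
        blaschke_det {s+1..n} \<alpha> (\<lambda>i. ext_inv \<phi>p (a i)) f h \<and>
        H = (\<lambda>t. h\<^sub>0 t * h t))"

end

theory Submission
  imports Defs
begin

text \<open>
  Multivalued as it is, \<open>f(z) = \<Prod>i. (z - a i) powr (\<alpha> i)\<close> has modulus 1 on \<open>\<Gamma>1\<close>. Pull \<open>f\<close> back to the
  unit disc by \<open>\<phi>m\<close> and divide by the Blaschke product \<open>A\<close>: the quotient has neither zeros nor poles
  in the disc and modulus 1 on the circle, so it is a constant of modulus 1. Likewise the
  quotient of \<open>f \<circ> \<phi>p\<close> by \<open>B\<close> is constant in the exterior of the disc, where the factor \<open>z powr \<alpha>\<close> of \<open>B\<close>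
  accounts for the behaviour at infinity. On the circle \<open>\<phi>p \<circ> k = \<phi>m\<close>, so comparing the two expressions
  for the same function gives \<open>B \<circ> k = cis \<theta> * A\<close>. As the exponents are real, everything is carried
  out with logarithms that are continuous up to the circle, and the ambiguity in their choice only
  changes weighted sums of logarithms by imaginary constants (\<open>weighted_logs_constant_on_disc\<close>,
  \<open>fingerprint_equation\<close>).

  Two points about the plane remain. First, \<open>k\<close> maps the circle to itself: lemniscates have empty
  interior, because otherwise the logarithmic derivative of \<open>f\<close>, and with it the polynomial \<open>p\<close>, would
  vanish on an open set, hence everywhere, whereas \<open>p\<close> has just two zeros inside \<open>\<Gamma>1\<close>; together with
  invariance of domain this puts the inner boundary of \<open>\<Gamma>1\<close> on its outer boundary
  (\<open>fingerprint_circle\<close>). Second, the first \<open>s\<close> poles, given inside \<open>\<Gamma>r\<close>, also lie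
  inside \<open>\<Gamma>1\<close>. Some pole lies inside \<open>\<Gamma>1\<close>, as otherwise \<open>f\<close> would have modulus 1 throughout
  the inside of \<open>\<Gamma>1\<close> (\<open>inside_contains_pole\<close>). Poles are not in the ring domain \<open>U\<close>, so this pole sits in a
  hole of \<open>U\<close>. The boundary of the holes, which belongs to \<open>\<Gamma>r\<close>, thus meets the inside of \<open>\<Gamma>1\<close>, and the
  connected set \<open>\<Gamma>r\<close>, being disjoint from \<open>\<Gamma>1\<close>, stays there
  (\<open>inside_subset_inside_of_separating\<close>).
\<close>

section \<open>Continuous logarithms\<close>

text \<open>The difference takes values in the discrete set \<open>2 * pi * \<i> * \<int>\<close>. Only its being purely imaginary
  matters later: weighted by the real exponents such differences add up to a unimodular factor.\<close>

lemma continuous_logs_differ_by_constant: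
  fixes L M :: "'a::topological_space \<Rightarrow> complex"
  assumes "connected S" "continuous_on S L" "continuous_on S M"
    and eq: "\<And>x. x \<in> S \<Longrightarrow> exp (L x) = exp (M x)"
  shows "\<exists>\<kappa>::real. \<forall>x\<in>S. L x = M x + \<i> * of_real \<kappa>"
proof -
  have rng: "\<exists>m::int. L x - M x = \<i> * of_real (2 * pi * m)" if x: "x \<in> S" for x
  proof -
    obtain m :: int where "L x = M x + complex_of_real (2 * of_int m * pi) * \<i>"
      using eq[OF x] by (auto simp: exp_eq)
    then show ?thesis by (intro exI[of _ m]) (simp add: algebra_simps)
  qed
  have "(\<lambda>x. L x - M x) constant_on S"
  proof (rule continuous_discrete_range_constant)
    show "continuous_on S (\<lambda>x. L x - M x)"
      using assms by (intro continuous_intros)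
    fix x assume x: "x \<in> S"
    have "2 * pi \<le> norm (L y - M y - (L x - M x))"
      if y: "y \<in> S" "L y - M y \<noteq> L x - M x" for y
    proof -
      obtain k m :: int where km: "L x - M x = \<i> * of_real (2 * pi * k)"
        "L y - M y = \<i> * of_real (2 * pi * m)" using rng x y(1) by blast
      then have "k \<noteq> m" using y(2) by auto
      have "L y - M y - (L x - M x) = \<i> * of_real (2 * pi * (m - k))"
        unfolding km by (simp add: algebra_simps)
      then have "norm (L y - M y - (L x - M x)) = 2 * pi * \<bar>real_of_int (m - k)\<bar>"
        by (simp only: norm_mult norm_of_real) (simp add: abs_mult)
      moreover have "1 \<le> \<bar>real_of_int (m - k)\<bar>" using \<open>k \<noteq> m\<close> by linarith
      ultimately show ?thesis by simp
    qed
    then show "\<exists>e>0. \<forall>y. y \<in> S \<and> L y - M y \<noteq> L x - M x \<longrightarrow> e \<le> norm (L y - M y - (L x - M x))"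
      by (intro exI[of _ "2 * pi"]) auto
  qed (use assms in auto)
  then obtain c where c: "\<And>x. x \<in> S \<Longrightarrow> L x - M x = c"
    by (auto simp: constant_on_def)
  show ?thesis
  proof (cases "S = {}")
    case False
    then obtain x where "x \<in> S" by auto
    with rng c obtain m :: int where "c = \<i> * of_real (2 * pi * m)" by metis
    with c show ?thesis by (metis add.commute diff_add_cancel)
  qed auto
qed

lemma norm_exp_powr: "norm (exp z) powr x = exp (x * Re z)" for z :: complex
  by (simp add: powr_def)

lemma power_det_exists:
  assumes "continuous_on UNIV f" "\<And>t. f t \<noteq> 0"
  shows "\<exists>h. power_det \<beta> f h"
proof -
  obtain L where "continuous_on UNIV L" "\<And>t. f t = exp (L t)"
    using continuous_logarithm_on_contractible[of UNIV f] assms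
      convex_imp_contractible[OF convex_UNIV] by (metis UNIV_I)
  then show ?thesis unfolding power_det_def
    by (intro exI[of _ "\<lambda>t. exp (of_real \<beta> * L t)"] exI[of _ L]) auto
qed

text \<open>The logarithm that is continuous up to the circle exists because the closed disc is contractible,
  and it is holomorphic inside because there it differs by a constant from a holomorphic one.\<close>

lemma holomorphic_log_on_closed_disc:
  assumes cont: "continuous_on (cball 0 1) f" and hol: "f holomorphic_on ball 0 1"
    and nz: "\<And>w. w \<in> cball 0 1 \<Longrightarrow> f w \<noteq> 0"
  obtains L where "continuous_on (cball 0 1) L" "L holomorphic_on ball 0 1"
    "\<And>w. w \<in> cball 0 1 \<Longrightarrow> exp (L w) = f w"
proof -
  obtain L where L: "continuous_on (cball 0 1) L" "\<And>w. w \<in> cball 0 1 \<Longrightarrow> f w = exp (L w)"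
    using continuous_logarithm_on_cball[OF cont nz] by blast
  obtain M where M: "M holomorphic_on ball 0 1" "\<And>w. w \<in> ball 0 1 \<Longrightarrow> f w = exp (M w)"
    using contractible_imp_holomorphic_log[OF hol convex_imp_contractible[OF convex_ball]] nz
    by (metis ball_subset_cball subsetD)
  have "\<exists>\<kappa>::real. \<forall>w\<in>ball 0 1. L w = M w + \<i> * of_real \<kappa>"
    using L M continuous_on_subset[OF L(1) ball_subset_cball]
    by (intro continuous_logs_differ_by_constant)
      (auto simp: holomorphic_on_imp_continuous_on)
  then obtain \<kappa> :: real where \<kappa>: "\<And>w. w \<in> ball 0 1 \<Longrightarrow> L w = M w + \<i> * of_real \<kappa>"
    by blast
  have "(\<lambda>w. M w + \<i> * of_real \<kappa>) holomorphic_on ball 0 1"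
    using M(1) by (intro holomorphic_intros)
  then have "L holomorphic_on ball 0 1"
    by (rule holomorphic_transform) (simp add: \<kappa>)
  then show thesis using that L by metis
qed

section \<open>Unimodular functions on the disc\<close>

text \<open>The exponential of \<open>g\<close> has constant modulus, so it is constant by the maximum principle;
  differentiating \<open>exp (g w)\<close> then gives \<open>g' = 0\<close>.\<close>

lemma holomorphic_constant_Re_imp_constant:
  assumes "g holomorphic_on S" "open S" "connected S"
    and "\<And>w. w \<in> S \<Longrightarrow> Re (g w) = c"
  shows "g constant_on S"
proof (cases "S = {}")
  case False
  then obtain x where x: "x \<in> S" by auto
  have d: "deriv g w = 0" if "w \<in> S" for w
  proof -
    have "(\<lambda>w. exp (g w)) constant_on S"
      using assms x by (intro maximum_modulus_principle[where U=S and \<xi>=x])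
         (auto intro!: holomorphic_intros)
    then obtain e where e: "\<And>w. w \<in> S \<Longrightarrow> exp (g w) = e" by (auto simp: constant_on_def)
    have "((\<lambda>w. exp (g w)) has_field_derivative exp (g w) * deriv g w) (at w)"
      using holomorphic_derivI[OF assms(1,2) that] by (auto intro!: derivative_eq_intros)
    moreover have "((\<lambda>w. exp (g w)) has_field_derivative 0) (at w)"
      using e that by (intro has_field_derivative_transform_within_open[OF DERIV_const[of e] \<open>open S\<close>]) auto
    ultimately show ?thesis using DERIV_unique by fastforce
  qed
  show ?thesis
    using assms d
    by (metis has_field_derivative_0_imp_constant_on holomorphic_derivI)
qed (auto simp: constant_on_def)

lemma Re_zero_on_circle_imp_constant:
  assumes "continuous_on (cball 0 1) g" "g holomorphic_on ball 0 1"
    and "\<And>w. norm w = 1 \<Longrightarrow> Re (g w) = 0"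
  shows "\<exists>\<theta>::real. \<forall>w\<in>cball 0 1. g w = \<i> * of_real \<theta>"
proof -
  have 1: "Re (g w) \<le> 0" if "w \<in> cball 0 1" for w
    using maximum_real_frontier[of g "cball 0 1" 0] assms that by auto
  have 2: "Re (- g w) \<le> 0" if "w \<in> cball 0 1" for w
    using maximum_real_frontier[of "\<lambda>w. - g w" "cball 0 1" 0] assms that
    by (auto intro!: holomorphic_intros continuous_intros)
  have Re0: "Re (g w) = 0" if "w \<in> cball 0 1" for w
    using 1 2 that by fastforce
  have "g constant_on ball 0 1"
    using assms(2) Re0 by (intro holomorphic_constant_Re_imp_constant[where c=0]) auto
  then have "g constant_on closure (ball 0 1)"
    using assms(1) by (intro constant_on_closureI) auto
  then obtain e where e: "\<And>w. w \<in> cball 0 1 \<Longrightarrow> g w = e" by (auto simp: constant_on_def)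
  moreover have "Re e = 0" using e[of 0] Re0[of 0] by simp
  ultimately show ?thesis
    by (intro exI[of _ "Im e"]) (auto simp: complex_eq_iff)
qed

text \<open>The engine of the proof: the multivalued function \<open>\<Prod>i. (Q i) powr (\<alpha> i)\<close> has modulus 1 on the
  circle and neither zeros nor poles, so it is a unimodular constant. Real exponents force the
  statement into logarithms.\<close>

lemma weighted_logs_constant_on_disc:
  fixes \<alpha> :: "'i \<Rightarrow> real"
  assumes cont: "\<And>i. i \<in> I \<Longrightarrow> continuous_on (cball 0 1) (Q i)"
    and hol: "\<And>i. i \<in> I \<Longrightarrow> Q i holomorphic_on ball 0 1"
    and nz: "\<And>i w. i \<in> I \<Longrightarrow> w \<in> cball 0 1 \<Longrightarrow> Q i w \<noteq> 0"
    and one: "\<And>w. norm w = 1 \<Longrightarrow> (\<Prod>i\<in>I. norm (Q i w) powr \<alpha> i) = 1"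
    and fin: "finite I"
  obtains L \<theta> where "\<And>i. i \<in> I \<Longrightarrow> continuous_on (cball 0 1) (L i)"
    "\<And>i w. i \<in> I \<Longrightarrow> w \<in> cball 0 1 \<Longrightarrow> exp (L i w) = Q i w"
    "\<And>w. w \<in> cball 0 1 \<Longrightarrow> (\<Sum>i\<in>I. of_real (\<alpha> i) * L i w) = \<i> * of_real \<theta>"
proof -
  have "\<exists>L. continuous_on (cball 0 1) L \<and> L holomorphic_on ball 0 1 \<and>
      (\<forall>w\<in>cball 0 1. exp (L w) = Q i w)" if "i \<in> I" for i
    using holomorphic_log_on_closed_disc[OF cont hol nz, OF that that that] by metis
  then obtain L where L: "\<And>i. i \<in> I \<Longrightarrow> continuous_on (cball 0 1) (L i)"
    "\<And>i. i \<in> I \<Longrightarrow> L i holomorphic_on ball 0 1"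
    "\<And>i w. i \<in> I \<Longrightarrow> w \<in> cball 0 1 \<Longrightarrow> exp (L i w) = Q i w"
    by metis
  have "\<exists>\<theta>::real. \<forall>w\<in>cball 0 1. (\<Sum>i\<in>I. of_real (\<alpha> i) * L i w) = \<i> * of_real \<theta>"
  proof (rule Re_zero_on_circle_imp_constant)
    show "continuous_on (cball 0 1) (\<lambda>w. \<Sum>i\<in>I. of_real (\<alpha> i) * L i w)"
      using L by (intro continuous_intros)
    show "(\<lambda>w. \<Sum>i\<in>I. of_real (\<alpha> i) * L i w) holomorphic_on ball 0 1"
      using L by (intro holomorphic_intros)
    fix w :: complex assume w: "norm w = 1"
    have "norm (Q i w) powr \<alpha> i = exp (\<alpha> i * Re (L i w))" if "i \<in> I" for i
      using L(3)[OF that, of w] w by (simp flip: norm_exp_powr del: norm_exp_eq_Re)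
    then have "exp (\<Sum>i\<in>I. \<alpha> i * Re (L i w)) = 1"
      using one[OF w] fin by (simp add: exp_sum)
    then show "Re (\<Sum>i\<in>I. of_real (\<alpha> i) * L i w) = 0" by simp
  qed
  then show thesis using that L by blast
qed

section \<open>Blaschke factors\<close>

lemma blaschke_denominator_nonzero:
  assumes "norm c < 1" "norm w \<le> 1"
  shows "1 - cnj c * w \<noteq> 0"
proof
  assume "1 - cnj c * w = 0"
  then have "norm (cnj c * w) = 1" by simp
  moreover have "norm (cnj c * w) \<le> norm c * 1"
    unfolding norm_mult complex_mod_cnj using assms by (intro mult_left_mono) auto
  ultimately show False using assms by linarith
qed

text \<open>For \<open>z * cnj z = 1\<close> the denominator is \<open>z\<close> times the conjugate of the numerator.\<close>

lemma norm_blaschke_factor_circle: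
  assumes "norm z = 1" "norm c \<noteq> 1"
  shows "norm (blaschke_factor c z) = 1"
proof -
  have "z * cnj z = 1" using assms(1) by (simp add: complex_norm_square[symmetric])
  then have "1 - cnj c * z = z * cnj (z - c)" by (simp add: algebra_simps)
  then have "norm (1 - cnj c * z) = norm (z - c)"
    using assms(1) by (simp add: norm_mult del: complex_cnj_diff)
  then show ?thesis using assms by (auto simp: blaschke_factor_def norm_divide)
qed

lemma blaschke_factor_curve:
  assumes "continuous_on UNIV f" "\<And>t. norm (f t) = 1" "norm c \<noteq> 1"
  shows "continuous_on UNIV (\<lambda>t. blaschke_factor c (f t))" "blaschke_factor c (f t) \<noteq> 0"
proof -
  have *: "norm (blaschke_factor c (f t)) = 1" for t
    using assms norm_blaschke_factor_circle by blast
  then show "blaschke_factor c (f t) \<noteq> 0" by (metis norm_zero zero_neq_one)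
  have "1 - cnj c * f t \<noteq> 0" for t
    using *[of t] by (auto simp: blaschke_factor_def)
  then show "continuous_on UNIV (\<lambda>t. blaschke_factor c (f t))"
    unfolding blaschke_factor_def using assms by (intro continuous_intros) auto
qed

lemma continuous_on_closed_disc_if_holomorphic_inside:
  assumes hol: "g holomorphic_on ball 0 1" and c: "c \<in> ball 0 1"
    and cont: "continuous_on (cball 0 1 - {c}) g"
  shows "continuous_on (cball 0 1) g"
  unfolding continuous_on_eq_continuous_within
proof
  fix w :: complex assume w: "w \<in> cball 0 1"
  show "continuous (at w within cball 0 1) g"
  proof (cases "w = c")
    case True
    then have "isCont g w"
      using hol c by (metis continuous_on_interior holomorphic_on_imp_continuous_on interior_ball)
    then show ?thesis by (rule continuous_at_imp_continuous_at_within)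
  next
    case False
    have "continuous (at w within (cball 0 1 - {c})) g"
      using w False cont by (auto simp: continuous_on_eq_continuous_within)
    moreover have "at w within (cball 0 1 - {c}) = at w within cball 0 1"
      using False by (intro at_within_nhd[of w "- {c}"]) auto
    ultimately show ?thesis by simp
  qed
qed

text \<open>A simple zero of \<open>f\<close> is removed by dividing by \<open>w - c\<close>; the factor \<open>1 - cnj c * w\<close> has no zero in the
  closed disc and turns \<open>w - c\<close> into a function that is unimodular on the circle.\<close>

lemma blaschke_factorization:
  assumes cont: "continuous_on (cball 0 1) f" and hol: "f holomorphic_on ball 0 1"
    and c: "c \<in> ball 0 1" "f c = 0" "deriv f c \<noteq> 0"
    and nz: "\<And>w. w \<in> cball 0 1 \<Longrightarrow> w \<noteq> c \<Longrightarrow> f w \<noteq> 0"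
  obtains Q where "continuous_on (cball 0 1) Q" "Q holomorphic_on ball 0 1"
    "\<And>w. w \<in> cball 0 1 \<Longrightarrow> Q w \<noteq> 0"
    "\<And>w. w \<in> cball 0 1 \<Longrightarrow> f w = blaschke_factor c w * Q w"
proof -
  define q where "q w = (if w = c then deriv f c else f w / (w - c))" for w
  have qhol: "q holomorphic_on ball 0 1"
    by (rule pole_theorem_open_0[OF hol open_ball, of c]) (auto simp: q_def c)
  have "continuous_on (cball 0 1 - {c}) (\<lambda>w. f w / (w - c))"
    by (intro continuous_intros continuous_on_subset[OF cont]) auto
  then have "continuous_on (cball 0 1 - {c}) q"
    by (rule continuous_on_eq) (auto simp: q_def)
  then have qcont: "continuous_on (cball 0 1) q"
    by (rule continuous_on_closed_disc_if_holomorphic_inside[OF qhol c(1)])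
  show thesis
  proof
    show "continuous_on (cball 0 1) (\<lambda>w. (1 - cnj c * w) * q w)"
      using qcont by (intro continuous_intros)
    show "(\<lambda>w. (1 - cnj c * w) * q w) holomorphic_on ball 0 1"
      using qhol by (intro holomorphic_intros)
    fix w :: complex assume w: "w \<in> cball 0 1"
    have d: "1 - cnj c * w \<noteq> 0" using blaschke_denominator_nonzero[of c w] c w by auto
    then show "(1 - cnj c * w) * q w \<noteq> 0"
      using c nz[OF w] by (auto simp: q_def)
    show "f w = blaschke_factor c w * ((1 - cnj c * w) * q w)"
      using d c by (auto simp: q_def blaschke_factor_def)
  qed
qed

section \<open>Splitting off the zeros of the conformal maps\<close>

lemma interior_blaschke_factorization:
  assumes cont: "continuous_on (cball 0 1) \<phi>" and hol: "\<phi> holomorphic_on ball 0 1"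
    and inj: "inj_on \<phi> (cball 0 1)" and b: "b \<notin> \<phi> ` sphere 0 1"
  obtains Q where "continuous_on (cball 0 1) Q" "Q holomorphic_on ball 0 1"
    "\<And>w. w \<in> cball 0 1 \<Longrightarrow> Q w \<noteq> 0"
    "\<And>w. w \<in> cball 0 1 \<Longrightarrow>
       \<phi> w - b = (if b \<in> \<phi> ` ball 0 1 then blaschke_factor (int_inv \<phi> b) w else 1) * Q w"
proof (cases "b \<in> \<phi> ` ball 0 1")
  case True
  then obtain c where c: "c \<in> ball 0 1" "\<phi> c = b" by auto
  then have ci: "int_inv \<phi> b = c"
    unfolding int_inv_def using inj by (auto intro!: inv_into_f_eq)
  have "deriv (\<lambda>w. \<phi> w - b) c = deriv \<phi> c"
    using holomorphic_derivI[OF hol open_ball c(1)]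
    by (intro DERIV_imp_deriv) (auto intro!: derivative_eq_intros)
  also have "\<dots> \<noteq> 0"
    using holomorphic_injective_imp_regular[OF hol open_ball _ c(1)] inj
    by (meson ball_subset_cball inj_on_subset)
  finally have d: "deriv (\<lambda>w. \<phi> w - b) c \<noteq> 0" .
  have nz: "\<phi> w - b \<noteq> 0" if "w \<in> cball 0 1" "w \<noteq> c" for w
    using inj_onD[OF inj, of w c] c that by auto
  obtain Q where "continuous_on (cball 0 1) Q" "Q holomorphic_on ball 0 1"
    "\<And>w. w \<in> cball 0 1 \<Longrightarrow> Q w \<noteq> 0"
    "\<And>w. w \<in> cball 0 1 \<Longrightarrow> \<phi> w - b = blaschke_factor c w * Q w"
    by (rule blaschke_factorization[of "\<lambda>w. \<phi> w - b" c])
      (use cont hol c d nz in \<open>auto intro!: continuous_intros holomorphic_intros\<close>)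
  then show thesis using True ci that by auto
next
  case False
  have "\<phi> w - b \<noteq> 0" if w: "w \<in> cball 0 1" for w
  proof
    assume "\<phi> w - b = 0"
    then have "b = \<phi> w" by simp
    with False b w show False by (cases "norm w = 1") auto
  qed
  then show thesis
    using False cont hol
    by (intro that[of "\<lambda>w. \<phi> w - b"]) (auto intro!: continuous_intros holomorphic_intros)
qed

text \<open>The exterior is pulled back to the disc by \<open>w = 1 / z\<close>. Since \<open>\<phi>\<close> has a simple pole at infinity,
  \<open>w * (\<phi> (1 / w) - b)\<close> extends holomorphically to \<open>w = 0\<close> with the nonzero value \<open>b0\<close>. This produces the
  factor \<open>z\<close>; taken once for each \<open>a i\<close> and raised to the power \<open>\<alpha> i\<close>, these factors make up \<open>z powr \<alpha>\<close> in \<open>B\<close>.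
  The factorization is stated on the circle, where it is compared with the interior one.\<close>

lemma exterior_blaschke_factorization:
  assumes cont: "continuous_on {z. 1 \<le> norm z} \<phi>" and hol: "\<phi> holomorphic_on {z. 1 < norm z}"
    and inj: "inj_on \<phi> {z. 1 \<le> norm z}" and b: "b \<notin> \<phi> ` sphere 0 1"
    and lim: "((\<lambda>z. \<phi> z / z) \<longlongrightarrow> b0) at_infinity" and b0: "b0 \<noteq> 0"
  obtains Q where "continuous_on (cball 0 1) Q" "Q holomorphic_on ball 0 1"
    "\<And>w. w \<in> cball 0 1 \<Longrightarrow> Q w \<noteq> 0"
    "\<And>z. norm z = 1 \<Longrightarrow>
       \<phi> z - b = z * (if b \<in> \<phi> ` {z. 1 < norm z} then blaschke_factor (ext_inv \<phi> b) z else 1) * Q (1 / z)"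
proof -
  have inv_gt: "1 < norm (1 / w)" if "w \<in> ball 0 1 - {0}" for w :: complex
    using that by (auto simp: norm_divide)
  have inv_ge: "1 \<le> norm (1 / w)" if "w \<in> cball 0 1 - {0}" for w :: complex
    using that by (auto simp: norm_divide)
  define f where "f w = w * (\<phi> (1 / w) - b)" for w
  define g where "g w = (if w = 0 then b0 else f w)" for w
  have fhol: "f holomorphic_on ball 0 1 - {0}"
  proof -
    have "(\<phi> \<circ> (\<lambda>w. 1 / w)) holomorphic_on ball 0 1 - {0}"
      using inv_gt by (intro holomorphic_on_compose_gen[OF _ hol]) (auto intro!: holomorphic_intros)
    then show ?thesis
      unfolding f_def o_def by (intro holomorphic_intros)
  qed
  have "f \<midarrow>0\<rightarrow> b0"
  proof -
    have "((\<lambda>w. \<phi> (1 / w) * w) \<longlongrightarrow> b0) (at 0)"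
      using lim unfolding lim_at_infinity_0 by (simp add: o_def field_simps)
    moreover have "((\<lambda>w. b * w) \<longlongrightarrow> b * 0) (at (0::complex))"
      by (intro tendsto_intros)
    ultimately have "((\<lambda>w. \<phi> (1 / w) * w - b * w) \<longlongrightarrow> b0 - b * 0) (at 0)"
      by (rule tendsto_diff)
    then show ?thesis by (simp add: f_def[abs_def] algebra_simps)
  qed
  then have ghol: "g holomorphic_on ball 0 1"
    unfolding g_def using fhol by (intro removable_singularity) auto
  have fcont: "continuous_on (cball 0 1 - {0}) f"
  proof -
    have "continuous_on (cball 0 1 - {0}) (\<phi> \<circ> (\<lambda>w. 1 / w))"
      using inv_ge
      by (intro continuous_on_compose continuous_on_subset[OF cont]) (auto intro!: continuous_intros)
    then show ?thesis
      unfolding f_def o_def by (intro continuous_intros)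
  qed
  have "continuous_on (cball 0 1 - {0}) g"
    using fcont by (rule continuous_on_eq) (auto simp: g_def)
  then have gcont: "continuous_on (cball 0 1) g"
    by (intro continuous_on_closed_disc_if_holomorphic_inside[OF ghol, of 0]) simp_all
  have gnz: "g w \<noteq> 0" if w: "w \<in> cball 0 1" "w = 0 \<or> \<phi> (1 / w) \<noteq> b" for w
    using that b0 by (auto simp: g_def f_def)
  have gz: "\<phi> z - b = z * g (1 / z)" if "norm z = 1" for z
    using that by (auto simp: g_def f_def)
  show thesis
  proof (cases "b \<in> \<phi> ` {z. 1 < norm z}")
    case True
    then obtain d where d: "1 < norm d" "\<phi> d = b" by auto
    then have d0: "d \<noteq> 0" by auto
    have di: "ext_inv \<phi> b = d"
      unfolding ext_inv_def using inj d by (auto intro!: inv_into_f_eq)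
    define c where "c = 1 / d"
    have c: "c \<in> ball 0 1" "c \<noteq> 0" "1 / c = d"
      using d d0 by (auto simp: c_def norm_divide)
    have op: "open {z::complex. 1 < norm z}"
      by (intro open_Collect_less continuous_intros)
    \<comment> \<open>The zero at \<open>c = 1 / d\<close> is simple because \<open>\<phi>\<close> is injective.\<close>
    have "(f has_field_derivative (\<phi> d - b) + c * (deriv \<phi> d * (- 1 / (c * c)))) (at c)"
    proof -
      have "(\<phi> has_field_derivative deriv \<phi> d) (at (1 / c))"
        using holomorphic_derivI[OF hol op, of d] d c by auto
      then have "((\<lambda>w. \<phi> (1 / w)) has_field_derivative deriv \<phi> d * (- 1 / (c * c))) (at c)"
        using c by (intro DERIV_chain2[where g = "\<lambda>w. 1 / w"]) (auto intro!: derivative_eq_intros)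
      then show ?thesis
        unfolding f_def using c by (auto intro!: derivative_eq_intros)
    qed
    then have "(f has_field_derivative - deriv \<phi> d / c) (at c)"
      using d c by simp
    then have "(g has_field_derivative - deriv \<phi> d / c) (at c)"
      using c by (elim has_field_derivative_transform_within_open[where S = "- {0}"])
        (auto simp: g_def)
    moreover have "deriv \<phi> d \<noteq> 0"
      using holomorphic_injective_imp_regular[OF hol op _, of d] d inj
      by (metis (mono_tags, lifting) inj_on_subset less_imp_le mem_Collect_eq subsetI)
    ultimately have gd: "deriv g c \<noteq> 0"
      using c by (simp add: DERIV_imp_deriv)
    have gc: "g c = 0" using c d by (simp add: g_def f_def)
    have nz: "g w \<noteq> 0" if "w \<in> cball 0 1" "w \<noteq> c" for w
    proof (cases "w = 0")
      case False
      have "1 / w \<noteq> d" using that(2) False d0 by (auto simp: c_def)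
      then have "\<phi> (1 / w) \<noteq> b"
        using inj_onD[OF inj, of "1 / w" d] d inv_ge[of w] that False by auto
      then show ?thesis using gnz that by auto
    qed (use gnz that in auto)
    obtain Q where Q: "continuous_on (cball 0 1) Q" "Q holomorphic_on ball 0 1"
      "\<And>w. w \<in> cball 0 1 \<Longrightarrow> Q w \<noteq> 0"
      "\<And>w. w \<in> cball 0 1 \<Longrightarrow> g w = blaschke_factor c w * Q w"
      by (rule blaschke_factorization[OF gcont ghol c(1) gc gd nz]) auto
    show thesis
    proof (rule that[of "\<lambda>w. cnj d / d * Q w"])
      fix z :: complex assume z: "norm z = 1"
      have z0: "z \<noteq> 0" using z by auto
      have "norm d \<noteq> 1" using d by simp
      then have "blaschke_factor d z \<noteq> 0"
        using norm_blaschke_factor_circle[OF z] by force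
      then have "1 - cnj d * z \<noteq> 0" by (auto simp: blaschke_factor_def)
      then have n: "cnj d * z - 1 \<noteq> 0" "1 - cnj d * z \<noteq> 0" by auto
      \<comment> \<open>Inversion takes the Blaschke factor of \<open>1 / d\<close> to that of \<open>d\<close> up to the factor \<open>cnj d / d\<close>.\<close>
      have "1 / z - 1 / d = (d - z) / (d * z)"
        using z0 d0 by (simp add: field_simps)
      moreover have "1 - cnj (1 / d) * (1 / z) = (cnj d * z - 1) / (cnj d * z)"
        using z0 d0 by (simp add: field_simps)
      ultimately have "blaschke_factor c (1 / z) = (d - z) * (cnj d * z) / (d * z * (cnj d * z - 1))"
        by (simp add: blaschke_factor_def c_def)
      also have "\<dots> = cnj d / d * ((d - z) / (cnj d * z - 1))"
        using z0 by simp
      also have "(d - z) / (cnj d * z - 1) = blaschke_factor d z"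
        using n by (simp add: blaschke_factor_def frac_eq_eq algebra_simps)
      finally have *: "blaschke_factor c (1 / z) = cnj d / d * blaschke_factor d z" .
      have "\<phi> z - b = z * (blaschke_factor c (1 / z) * Q (1 / z))"
        using Q(4)[of "1 / z"] gz[OF z] z by (simp add: norm_divide)
      then show "\<phi> z - b = z * (if b \<in> \<phi> ` {z. 1 < norm z} then blaschke_factor (ext_inv \<phi> b) z else 1) *
          (cnj d / d * Q (1 / z))"
        using True by (simp add: di *)
    qed (use Q d0 in \<open>auto intro!: continuous_intros holomorphic_intros\<close>)
  next
    case False
    have nz: "g w \<noteq> 0" if "w \<in> cball 0 1" for w
    proof (rule gnz[OF that])
      show "w = 0 \<or> \<phi> (1 / w) \<noteq> b"
      proof (cases "w = 0")
        case w0: False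
        then have "1 \<le> norm (1 / w)" using inv_ge that by auto
        then have "1 / w \<in> sphere 0 1 \<or> 1 / w \<in> {z. 1 < norm z}" by auto
        then show ?thesis using False b by (metis image_eqI)
      qed auto
    qed
    show thesis
      using False gz by (intro that[of g] gcont ghol nz) auto
  qed
qed

section \<open>Boundary behaviour of the conformal maps\<close>

lemma interior_map_topology:
  assumes "interior_map \<Gamma> \<phi>"
  shows "continuous_on (cball 0 1) \<phi>" "inj_on \<phi> (cball 0 1)" "\<phi> holomorphic_on ball 0 1"
    "\<phi> ` cball 0 1 = closure (inside \<Gamma>)" "\<phi> ` ball 0 1 = inside \<Gamma>"
    "open (inside \<Gamma>)" "connected (inside \<Gamma>)" "infinite (inside \<Gamma>)"
proof -
  obtain \<psi> where h: "homeomorphism (cball 0 1) (closure (inside \<Gamma>)) \<phi> \<psi>"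
    using assms unfolding interior_map_def by blast
  show c: "continuous_on (cball 0 1) \<phi>" and i: "inj_on \<phi> (cball 0 1)"
    and "\<phi> ` cball 0 1 = closure (inside \<Gamma>)"
    using h by (auto simp: homeomorphism_def intro: inj_on_inverseI)
  show "\<phi> holomorphic_on ball 0 1" and im: "\<phi> ` ball 0 1 = inside \<Gamma>"
    using assms by (auto simp: interior_map_def bij_betw_def)
  have cb: "continuous_on (ball 0 1) \<phi>" "inj_on \<phi> (ball 0 1)"
    using c i ball_subset_cball by (auto intro: continuous_on_subset inj_on_subset)
  show "open (inside \<Gamma>)" "connected (inside \<Gamma>)"
    using invariance_of_domain[OF cb(1) open_ball cb(2)] connected_continuous_image[OF cb(1)] im
    by auto
  have "infinite (ball (0::complex) 1)"
    by (intro uncountable_infinite uncountable_ball) auto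
  then show "infinite (inside \<Gamma>)"
    using finite_imageD[OF _ cb(2)] im by auto
qed

lemma exterior_map_topology:
  assumes "exterior_map \<Gamma> \<phi>"
  shows "continuous_on {z. 1 \<le> norm z} \<phi>" "inj_on \<phi> {z. 1 \<le> norm z}"
    "\<phi> holomorphic_on {z. 1 < norm z}"
    "\<phi> ` {z. 1 \<le> norm z} = closure (outside \<Gamma>)" "\<phi> ` {z. 1 < norm z} = outside \<Gamma>"
    "open (outside \<Gamma>)" "continuous_on (closure (outside \<Gamma>)) (ext_inv \<phi>)"
proof -
  obtain \<psi> where h: "homeomorphism {z. 1 \<le> norm z} (closure (outside \<Gamma>)) \<phi> \<psi>"
    using assms unfolding exterior_map_def by blast
  show c: "continuous_on {z. 1 \<le> norm z} \<phi>" and i: "inj_on \<phi> {z. 1 \<le> norm z}"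
    and im1: "\<phi> ` {z. 1 \<le> norm z} = closure (outside \<Gamma>)"
    using h by (auto simp: homeomorphism_def intro: inj_on_inverseI)
  show "\<phi> holomorphic_on {z. 1 < norm z}" and im: "\<phi> ` {z. 1 < norm z} = outside \<Gamma>"
    using assms by (auto simp: exterior_map_def bij_betw_def)
  have cb: "continuous_on {z. 1 < norm z} \<phi>" "inj_on \<phi> {z. 1 < norm z}"
    using c i by (auto intro: continuous_on_subset inj_on_subset)
  have "open {z::complex. 1 < norm z}"
    by (intro open_Collect_less continuous_intros)
  then show "open (outside \<Gamma>)"
    using invariance_of_domain[OF cb(1) _ cb(2)] im by auto
  have "\<psi> x = ext_inv \<phi> x" if "x \<in> closure (outside \<Gamma>)" for x
    unfolding ext_inv_def using h that i
    by (intro inv_into_f_eq[symmetric]) (auto simp: homeomorphism_def)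
  then show "continuous_on (closure (outside \<Gamma>)) (ext_inv \<phi>)"
    using h by (auto simp: homeomorphism_def cong: continuous_on_cong)
qed

lemma norm_int_inv_less_1:
  assumes "interior_map \<Gamma> \<phi>" "b \<in> inside \<Gamma>"
  shows "norm (int_inv \<phi> b) < 1"
proof -
  note t = interior_map_topology[OF assms(1)]
  have "b \<in> \<phi> ` ball 0 1" using assms(2) t(5) by simp
  then obtain c where "c \<in> ball 0 1" "b = \<phi> c" by blast
  then show ?thesis
    unfolding int_inv_def using inv_into_f_f[OF t(2), of c] by auto
qed

lemma norm_ext_inv_greater_1:
  assumes "exterior_map \<Gamma> \<phi>" "b \<in> outside \<Gamma>"
  shows "1 < norm (ext_inv \<phi> b)"
proof -
  note t = exterior_map_topology[OF assms(1)]
  have "b \<in> \<phi> ` {z. 1 < norm z}" using assms(2) t(5) by simp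
  then obtain c where "1 < norm c" "b = \<phi> c" by blast
  then show ?thesis
    unfolding ext_inv_def using inv_into_f_f[OF t(2), of c] by auto
qed

lemma interior_map_circle:
  assumes m: "interior_map \<Gamma> \<phi>" "open (outside \<Gamma>)" and z: "norm z = 1"
  shows "\<phi> z \<in> \<Gamma>"
proof (rule ccontr)
  note t = interior_map_topology[OF m(1)]
  assume "\<phi> z \<notin> \<Gamma>"
  moreover have "\<phi> z \<notin> inside \<Gamma>"
  proof
    assume "\<phi> z \<in> inside \<Gamma>"
    then have "\<phi> z \<in> \<phi> ` ball 0 1" using t(5) by simp
    then obtain w where w: "w \<in> ball 0 1" "\<phi> w = \<phi> z" by fastforce
    then show False using inj_onD[OF t(2) w(2)] z by auto
  qed
  ultimately have "\<phi> z \<in> outside \<Gamma>" using inside_Un_outside[of \<Gamma>] by blast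
  moreover have "\<phi> z \<in> closure (inside \<Gamma>)" using t(4) z by auto
  ultimately show False
    using m(2) inside_Int_outside[of \<Gamma>] open_Int_closure_eq_empty by blast
qed

lemma exterior_map_circle:
  assumes m: "exterior_map \<Gamma> \<phi>" "open (inside \<Gamma>)" and z: "norm z = 1"
  shows "\<phi> z \<in> \<Gamma>"
proof (rule ccontr)
  note t = exterior_map_topology[OF m(1)]
  assume "\<phi> z \<notin> \<Gamma>"
  moreover have "\<phi> z \<notin> outside \<Gamma>"
  proof
    assume "\<phi> z \<in> outside \<Gamma>"
    then have "\<phi> z \<in> \<phi> ` {z. 1 < norm z}" using t(5) by simp
    then obtain w where w: "1 < norm w" "\<phi> w = \<phi> z" by fastforce
    then show False using inj_onD[OF t(2) w(2)] z by auto
  qed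
  ultimately have "\<phi> z \<in> inside \<Gamma>" using inside_Un_outside[of \<Gamma>] by blast
  moreover have "\<phi> z \<in> closure (outside \<Gamma>)" using t(4) z by auto
  ultimately show False
    using m(2) inside_Int_outside[of \<Gamma>] open_Int_closure_eq_empty by blast
qed

text \<open>Points near \<open>\<phi> z\<close> outside the closed Jordan domain cannot all belong to \<open>\<Gamma>\<close> as \<open>\<Gamma>\<close> has no interior
  points; and they exist, since otherwise the inverse of \<open>\<phi>\<close> would map a whole neighbourhood of \<open>\<phi> z\<close>
  homeomorphically into the closed disc, which invariance of domain forbids at the boundary point \<open>z\<close>.\<close>

lemma interior_map_circle_closure_outside:
  assumes m: "interior_map \<Gamma> \<phi>" "open (outside \<Gamma>)" and z: "norm z = 1"
    and "interior \<Gamma> = {}"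
  shows "\<phi> z \<in> closure (outside \<Gamma>)"
proof (rule ccontr)
  note t = interior_map_topology[OF m(1)]
  define V where "V = - closure (outside \<Gamma>)"
  assume "\<phi> z \<notin> closure (outside \<Gamma>)"
  then have V: "open V" "\<phi> z \<in> V" by (auto simp: V_def)
  have "V \<subseteq> inside \<Gamma> \<union> \<Gamma>"
    unfolding V_def using closure_subset[of "outside \<Gamma>"] inside_Un_outside[of \<Gamma>] by blast
  then have "V - closure (inside \<Gamma>) \<subseteq> \<Gamma>" using closure_subset by fastforce
  moreover have "open (V - closure (inside \<Gamma>))" using V(1) by (intro open_Diff) auto
  ultimately have "V - closure (inside \<Gamma>) = {}"
    using assms(4) interior_maximal by blast
  then have Vim: "V \<subseteq> \<phi> ` cball 0 1" using t(4) by auto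
  obtain \<psi> where h: "homeomorphism (cball 0 1) (closure (inside \<Gamma>)) \<phi> \<psi>"
    using m(1) unfolding interior_map_def by blast
  have "open (\<psi> ` V)"
  proof (rule invariance_of_domain)
    show "continuous_on V \<psi>"
      using h Vim t(4) by (auto simp: homeomorphism_def intro: continuous_on_subset)
    show "inj_on \<psi> V"
      using h Vim t(4) by (intro inj_on_inverseI[of _ \<phi>]) (auto simp: homeomorphism_def)
  qed (rule V(1))
  moreover have "\<psi> ` V \<subseteq> cball 0 1"
    using Vim h t(4) image_mono[of V "closure (inside \<Gamma>)" \<psi>] by (simp add: homeomorphism_def)
  ultimately have "\<psi> ` V \<subseteq> ball 0 1"
    using interior_maximal[of "\<psi> ` V" "cball 0 1"] by simp
  moreover have "\<psi> (\<phi> z) = z" using h z by (auto simp: homeomorphism_def)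
  ultimately show False using V(2) z by force
qed

text \<open>In general \<open>\<Gamma>\<close> may have different inner and outer boundaries; the empty interior of \<open>\<Gamma>\<close> ensures
  that the inner boundary lies on the outer one, where the exterior map can be inverted.\<close>

lemma fingerprint_circle:
  assumes m: "interior_map \<Gamma> \<phi>m" "exterior_map \<Gamma> \<phi>p" and z: "norm z = 1"
    and i: "interior \<Gamma> = {}"
  shows "norm (fingerprint \<phi>m \<phi>p z) = 1" "\<phi>p (fingerprint \<phi>m \<phi>p z) = \<phi>m z"
proof -
  note t = exterior_map_topology[OF m(2)]
  have "\<phi>m z \<in> \<phi>p ` {z. 1 \<le> norm z}"
    using interior_map_circle_closure_outside[OF m(1) t(6) z i] t(4) by auto
  then have *: "fingerprint \<phi>m \<phi>p z \<in> {z. 1 \<le> norm z}" "\<phi>p (fingerprint \<phi>m \<phi>p z) = \<phi>m z"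
    unfolding fingerprint_def ext_inv_def by (rule inv_into_into, rule f_inv_into_f)
  then show "\<phi>p (fingerprint \<phi>m \<phi>p z) = \<phi>m z" by simp
  have "\<phi>m z \<notin> outside \<Gamma>"
    using interior_map_circle[OF m(1) t(6) z] outside_no_overlap[of \<Gamma>] by blast
  then have "\<phi>p (fingerprint \<phi>m \<phi>p z) \<notin> \<phi>p ` {z. 1 < norm z}"
    using *(2) t(5) by simp
  then have "\<not> 1 < norm (fingerprint \<phi>m \<phi>p z)" by blast
  then show "norm (fingerprint \<phi>m \<phi>p z) = 1" using *(1) by simp
qed

lemma continuous_on_fingerprint_cis:
  assumes m: "interior_map \<Gamma> \<phi>m" "exterior_map \<Gamma> \<phi>p"
    and i: "interior \<Gamma> = {}"
  shows "continuous_on UNIV (\<lambda>t. fingerprint \<phi>m \<phi>p (cis t))"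
proof -
  note t = exterior_map_topology[OF m(2)]
  have "continuous_on UNIV (\<lambda>t. \<phi>m (cis t))"
    by (rule continuous_on_compose2[OF interior_map_topology(1)[OF m(1)]])
      (auto intro!: continuous_intros)
  then show ?thesis
    unfolding fingerprint_def
    by (rule continuous_on_compose2[OF t(7)])
      (use interior_map_circle_closure_outside[OF m(1) t(6) _ i] in auto)
qed

section \<open>Lemniscates have empty interior\<close>

lemma lemniscate_pole_notin:
  assumes "i \<in> {1..n}" "l \<noteq> 0"
  shows "a i \<notin> lemniscate n a \<alpha> l"
  using assms by (force simp: lemniscate_def)

text \<open>Locally \<open>log_deriv\<close> is the derivative of a holomorphic branch of \<open>\<Sum>i. \<alpha> i * log (z - a i)\<close>, and on a
  lemniscate the real part of such a branch is \<open>ln l\<close>.\<close>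

lemma log_deriv_zero_on_open_lemniscate_subset:
  assumes V: "open V" "V \<subseteq> lemniscate n a \<alpha> l" and l: "l \<noteq> 0" and z: "z \<in> V"
  shows "log_deriv n a \<alpha> z = 0"
proof -
  obtain e where e: "e > 0" "ball z e \<subseteq> V" using V z openE by blast
  have nz: "w - a i \<noteq> 0" if "i \<in> {1..n}" "w \<in> V" for i w
    using lemniscate_pole_notin[OF that(1) l, of a \<alpha>] V(2) that(2) by auto
  have "\<exists>L. L holomorphic_on ball z e \<and> (\<forall>w\<in>ball z e. w - a i = exp (L w))"
    if "i \<in> {1..n}" for i
  proof -
    have "(\<lambda>w. w - a i) holomorphic_on ball z e" by (intro holomorphic_intros)
    moreover have "w - a i \<noteq> 0" if "w \<in> ball z e" for w
      using nz[OF \<open>i \<in> {1..n}\<close>] e(2) that by blast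
    ultimately show ?thesis
      using contractible_imp_holomorphic_log[of "\<lambda>w. w - a i" "ball z e"]
        convex_imp_contractible[OF convex_ball] by metis
  qed
  then obtain L where L: "\<And>i. i \<in> {1..n} \<Longrightarrow> L i holomorphic_on ball z e"
    "\<And>i w. i \<in> {1..n} \<Longrightarrow> w \<in> ball z e \<Longrightarrow> exp (L i w) = w - a i"
    by metis
  define g where "g w = (\<Sum>i=1..n. of_real (\<alpha> i) * L i w)" for w
  have ghol: "g holomorphic_on ball z e"
    unfolding g_def using L by (intro holomorphic_intros) auto
  have "Re (g w) = ln l" if w: "w \<in> ball z e" for w
  proof -
    have "norm (w - a i) powr \<alpha> i = exp (\<alpha> i * Re (L i w))" if "i \<in> {1..n}" for i
      by (simp only: L(2)[OF that w, symmetric] norm_exp_powr)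
    then have "exp (\<Sum>i=1..n. \<alpha> i * Re (L i w)) = (\<Prod>i=1..n. norm (w - a i) powr \<alpha> i)"
      by (simp add: exp_sum)
    also have "\<dots> = l"
      using e V(2) w by (auto simp: lemniscate_def)
    finally have "exp (\<Sum>i=1..n. \<alpha> i * Re (L i w)) = l" .
    then have "(\<Sum>i=1..n. \<alpha> i * Re (L i w)) = ln l" by (metis ln_exp)
    then show ?thesis by (simp add: g_def)
  qed
  then have "g constant_on ball z e"
    using ghol by (intro holomorphic_constant_Re_imp_constant) auto
  then obtain c where "\<And>w. w \<in> ball z e \<Longrightarrow> g w = c" by (auto simp: constant_on_def)
  then have "(g has_field_derivative 0) (at z)"
    using e by (intro has_field_derivative_transform_within_open[OF DERIV_const[of c] open_ball[of z e]]) auto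
  moreover have "(g has_field_derivative log_deriv n a \<alpha> z) (at z)"
  proof -
    have "(L i has_field_derivative 1 / (z - a i)) (at z)" if i: "i \<in> {1..n}" for i
    proof -
      have d: "(L i has_field_derivative deriv (L i) z) (at z)"
        using holomorphic_derivI[OF L(1)[OF i] open_ball] e by auto
      then have "((\<lambda>w. exp (L i w)) has_field_derivative exp (L i z) * deriv (L i) z) (at z)"
        by (rule DERIV_fun_exp)
      moreover have "((\<lambda>w. exp (L i w)) has_field_derivative 1) (at z)"
      proof (rule has_field_derivative_transform_within_open)
        show "((\<lambda>w. w - a i) has_field_derivative 1) (at z)"
          by (auto intro!: derivative_eq_intros)
        show "w - a i = exp (L i w)" if "w \<in> ball z e" for w
          by (rule L(2)[OF i that, symmetric])
      qed (use e in auto)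
      ultimately have "exp (L i z) * deriv (L i) z = 1" by (rule DERIV_unique)
      then have "deriv (L i) z = 1 / (z - a i)"
        using L(2)[OF i, of z] e nz[OF i z] by (simp add: field_simps)
      with d show ?thesis by simp
    qed
    then have "(g has_field_derivative (\<Sum>i=1..n. of_real (\<alpha> i) * (1 / (z - a i)))) (at z)"
      unfolding g_def by (intro DERIV_sum DERIV_cmult) auto
    then show ?thesis by (simp add: log_deriv_def)
  qed
  ultimately show ?thesis using DERIV_unique by blast
qed

lemma interior_lemniscate_empty:
  assumes p: "\<And>z. z \<notin> a ` {1..n} \<Longrightarrow>
              (\<Sum>i=1..n. of_real (\<alpha> i) / (z - a i)) = poly p z / (\<Prod>i=1..n. z - a i)"
    and "p \<noteq> 0" and l: "l \<noteq> 0"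
  shows "interior (lemniscate n a \<alpha> l) = {}"
proof (rule ccontr)
  define V where "V = interior (lemniscate n a \<alpha> l)"
  assume "interior (lemniscate n a \<alpha> l) \<noteq> {}"
  then obtain z where z: "z \<in> V" by (auto simp: V_def)
  have V: "open V" "V \<subseteq> lemniscate n a \<alpha> l" by (auto simp: V_def interior_subset)
  have "poly p w = 0" if w: "w \<in> V" for w
  proof -
    have na: "w \<notin> a ` {1..n}" using lemniscate_pole_notin[OF _ l, of _ n a \<alpha>] V(2) w by blast
    then have "poly p w / (\<Prod>i=1..n. w - a i) = 0"
      using log_deriv_zero_on_open_lemniscate_subset[OF V l w] p by (simp add: log_deriv_def)
    then show ?thesis using na by auto
  qed
  then have "V \<subseteq> {w. poly p w = 0}" by auto
  then have "finite V" using poly_roots_finite[OF \<open>p \<noteq> 0\<close>] finite_subset by blast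
  then show False using z V(1) finite_imp_not_open by blast
qed

section \<open>The level function as a Blaschke product\<close>

text \<open>The interior half of the functional equation: \<open>\<Prod>i. (\<phi> w - a i) powr (\<alpha> i)\<close> is a unimodular constant
  times the Blaschke product of the poles inside.\<close>

lemma interior_logs_with_constant_sum:
  assumes m: "interior_map \<Gamma> \<phi>"
    and lem: "\<And>w. norm w = 1 \<Longrightarrow> \<phi> w \<in> lemniscate n a \<alpha> 1"
  obtains L \<theta> where "\<And>i. i \<in> {1..n} \<Longrightarrow> continuous_on (cball 0 1) (L i)"
    "\<And>i w. i \<in> {1..n} \<Longrightarrow> w \<in> cball 0 1 \<Longrightarrow> \<phi> w - a i =
       (if a i \<in> inside \<Gamma> then blaschke_factor (int_inv \<phi> (a i)) w else 1) * exp (L i w)"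
    "\<And>w. w \<in> cball 0 1 \<Longrightarrow> (\<Sum>i=1..n. of_real (\<alpha> i) * L i w) = \<i> * of_real \<theta>"
proof -
  note t = interior_map_topology[OF m]
  define bf where "bf i w = (if a i \<in> inside \<Gamma> then blaschke_factor (int_inv \<phi> (a i)) w else 1)" for i w
  have "\<exists>Q. continuous_on (cball 0 1) Q \<and> Q holomorphic_on ball 0 1 \<and>
      (\<forall>w\<in>cball 0 1. Q w \<noteq> 0) \<and> (\<forall>w\<in>cball 0 1. \<phi> w - a i = bf i w * Q w)"
    if i: "i \<in> {1..n}" for i
  proof -
    have "a i \<notin> \<phi> ` sphere 0 1"
      using lem lemniscate_pole_notin[OF i, of 1 a \<alpha>] by auto
    from interior_blaschke_factorization[OF t(1,3,2) this]
    show ?thesis unfolding bf_def t(5) by metis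
  qed
  then obtain Q where Q: "\<And>i. i \<in> {1..n} \<Longrightarrow> continuous_on (cball 0 1) (Q i)"
    "\<And>i. i \<in> {1..n} \<Longrightarrow> Q i holomorphic_on ball 0 1"
    "\<And>i w. i \<in> {1..n} \<Longrightarrow> w \<in> cball 0 1 \<Longrightarrow> Q i w \<noteq> 0"
    "\<And>i w. i \<in> {1..n} \<Longrightarrow> w \<in> cball 0 1 \<Longrightarrow> \<phi> w - a i = bf i w * Q i w"
    by metis
  have "(\<Prod>i=1..n. norm (Q i w) powr \<alpha> i) = 1" if w: "norm w = 1" for w
  proof -
    have bf1: "norm (bf i w) = 1" for i
    proof (cases "a i \<in> inside \<Gamma>")
      case True
      then have "norm (int_inv \<phi> (a i)) \<noteq> 1" using norm_int_inv_less_1[OF m] by fastforce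
      then show ?thesis using norm_blaschke_factor_circle[OF w] True by (simp add: bf_def)
    qed (simp add: bf_def)
    have "norm (\<phi> w - a i) = norm (Q i w)" if "i \<in> {1..n}" for i
      using Q(4)[OF that, of w] bf1 w by (simp add: norm_mult)
    then show ?thesis using lem[OF w] by (simp add: lemniscate_def)
  qed
  from weighted_logs_constant_on_disc[OF Q(1-3) this]
  obtain L \<theta> where L: "\<And>i. i \<in> {1..n} \<Longrightarrow> continuous_on (cball 0 1) (L i)"
    "\<And>i w. i \<in> {1..n} \<Longrightarrow> w \<in> cball 0 1 \<Longrightarrow> exp (L i w) = Q i w"
    "\<And>w. w \<in> cball 0 1 \<Longrightarrow> (\<Sum>i\<in>{1..n}. of_real (\<alpha> i) * L i w) = \<i> * of_real \<theta>"
    by auto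
  show thesis
    using Q(4) L(2) by (intro that[OF L(1) _ L(3)]) (auto simp: bf_def)
qed

text \<open>The exterior half of the functional equation. The variable of the logarithms is \<open>1 / z\<close>, in which the
  exterior including infinity becomes the disc.\<close>

lemma exterior_logs_with_constant_sum:
  assumes m: "exterior_map \<Gamma> \<phi>"
    and lem: "\<And>w. norm w = 1 \<Longrightarrow> \<phi> w \<in> lemniscate n a \<alpha> 1"
  obtains M \<theta> where "\<And>i. i \<in> {1..n} \<Longrightarrow> continuous_on (cball 0 1) (M i)"
    "\<And>i z. i \<in> {1..n} \<Longrightarrow> norm z = 1 \<Longrightarrow> \<phi> z - a i =
       z * (if a i \<in> outside \<Gamma> then blaschke_factor (ext_inv \<phi> (a i)) z else 1) * exp (M i (1 / z))"
    "\<And>w. w \<in> cball 0 1 \<Longrightarrow> (\<Sum>i=1..n. of_real (\<alpha> i) * M i w) = \<i> * of_real \<theta>"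
proof -
  note t = exterior_map_topology[OF m]
  obtain b0 :: real where b0: "b0 > 0" "((\<lambda>z. \<phi> z / z) \<longlongrightarrow> complex_of_real b0) at_infinity"
    using m unfolding exterior_map_def by blast
  then have b0': "complex_of_real b0 \<noteq> 0" by simp
  define bf where "bf i w = (if a i \<in> outside \<Gamma> then blaschke_factor (ext_inv \<phi> (a i)) w else 1)" for i w
  have "\<exists>Q. continuous_on (cball 0 1) Q \<and> Q holomorphic_on ball 0 1 \<and>
      (\<forall>w\<in>cball 0 1. Q w \<noteq> 0) \<and> (\<forall>z. norm z = 1 \<longrightarrow> \<phi> z - a i = z * bf i z * Q (1 / z))"
    if i: "i \<in> {1..n}" for i
  proof -
    have "a i \<notin> \<phi> ` sphere 0 1"
      using lem lemniscate_pole_notin[OF i, of 1 a \<alpha>] by auto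
    from exterior_blaschke_factorization[OF t(1,3,2) this b0(2) b0']
    show ?thesis unfolding bf_def t(5) by metis
  qed
  then obtain Q where Q: "\<And>i. i \<in> {1..n} \<Longrightarrow> continuous_on (cball 0 1) (Q i)"
    "\<And>i. i \<in> {1..n} \<Longrightarrow> Q i holomorphic_on ball 0 1"
    "\<And>i w. i \<in> {1..n} \<Longrightarrow> w \<in> cball 0 1 \<Longrightarrow> Q i w \<noteq> 0"
    "\<And>i z. i \<in> {1..n} \<Longrightarrow> norm z = 1 \<Longrightarrow> \<phi> z - a i = z * bf i z * Q i (1 / z)"
    by metis
  have "(\<Prod>i=1..n. norm (Q i w) powr \<alpha> i) = 1" if w: "norm w = 1" for w
  proof -
    have z: "norm (1 / w) = 1" using w by (simp add: norm_divide)
    have bf1: "norm (bf i (1 / w)) = 1" for i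
    proof (cases "a i \<in> outside \<Gamma>")
      case True
      then have "norm (ext_inv \<phi> (a i)) \<noteq> 1" using norm_ext_inv_greater_1[OF m] by fastforce
      then show ?thesis using norm_blaschke_factor_circle[OF z] True by (simp add: bf_def)
    qed (simp add: bf_def)
    have "norm (\<phi> (1 / w) - a i) = norm (Q i w)" if "i \<in> {1..n}" for i
      using Q(4)[OF that z] bf1[of i] w by (simp add: norm_mult norm_divide)
    then show ?thesis using lem[OF z] by (simp add: lemniscate_def)
  qed
  from weighted_logs_constant_on_disc[OF Q(1-3) this]
  obtain M \<theta> where M: "\<And>i. i \<in> {1..n} \<Longrightarrow> continuous_on (cball 0 1) (M i)"
    "\<And>i w. i \<in> {1..n} \<Longrightarrow> w \<in> cball 0 1 \<Longrightarrow> exp (M i w) = Q i w"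
    "\<And>w. w \<in> cball 0 1 \<Longrightarrow> (\<Sum>i\<in>{1..n}. of_real (\<alpha> i) * M i w) = \<i> * of_real \<theta>"
    by auto
  show thesis
    using Q(4) M(2) by (intro that[OF M(1) _ M(3)]) (auto simp: bf_def norm_divide)
qed

section \<open>Location of the poles\<close>

text \<open>Otherwise no Blaschke factor occurs in the interior half of the functional equation, which then
  says that the open set \<open>inside \<Gamma>\<close> is contained in the lemniscate.\<close>

lemma inside_contains_pole:
  assumes m: "interior_map \<Gamma> \<phi>"
    and lem: "\<And>w. norm w = 1 \<Longrightarrow> \<phi> w \<in> lemniscate n a \<alpha> 1"
    and thin: "interior (lemniscate n a \<alpha> 1) = {}"
  shows "\<exists>i\<in>{1..n}. a i \<in> inside \<Gamma>"
proof (rule ccontr)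
  assume "\<not> ?thesis"
  then have out: "a i \<notin> inside \<Gamma>" if "i \<in> {1..n}" for i using that by blast
  note t = interior_map_topology[OF m]
  obtain L \<theta> where "\<And>i. i \<in> {1..n} \<Longrightarrow> continuous_on (cball 0 1) (L i)"
    and L: "\<And>i w. i \<in> {1..n} \<Longrightarrow> w \<in> cball 0 1 \<Longrightarrow> \<phi> w - a i =
       (if a i \<in> inside \<Gamma> then blaschke_factor (int_inv \<phi> (a i)) w else 1) * exp (L i w)"
    "\<And>w. w \<in> cball 0 1 \<Longrightarrow> (\<Sum>i=1..n. of_real (\<alpha> i) * L i w) = \<i> * of_real \<theta>"
    by (rule interior_logs_with_constant_sum[OF m lem], assumption, rule that)
  have "\<phi> w \<in> lemniscate n a \<alpha> 1" if w: "w \<in> ball 0 1" for w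
  proof -
    have w': "w \<in> cball 0 1" using w by auto
    have "(\<Prod>i=1..n. norm (\<phi> w - a i) powr \<alpha> i) = exp (\<Sum>i=1..n. \<alpha> i * Re (L i w))"
      using L(1)[OF _ w'] out by (simp add: exp_sum norm_exp_powr del: norm_exp_eq_Re)
    also have "(\<Sum>i=1..n. \<alpha> i * Re (L i w)) = Re (\<Sum>i=1..n. of_real (\<alpha> i) * L i w)"
      by simp
    also have "\<dots> = 0" unfolding L(2)[OF w'] by simp
    finally show ?thesis by (simp add: lemniscate_def)
  qed
  then have "\<phi> ` ball 0 1 \<subseteq> lemniscate n a \<alpha> 1" by blast
  then have "inside \<Gamma> \<subseteq> interior (lemniscate n a \<alpha> 1)"
    unfolding t(5) using t(6) by (rule interior_maximal)
  then show False using t(8) thin by simp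
qed

lemma ring_domain_open:
  assumes "ring_domain n a \<alpha> U"
  shows "open U"
proof -
  obtain r R h where h: "h holomorphic_on {w. r < norm w \<and> norm w < R}"
    "bij_betw h {w. r < norm w \<and> norm w < R} U"
    using assms unfolding ring_domain_def by blast
  have "open {w::complex. r < norm w \<and> norm w < R}"
    by (intro open_Collect_conj open_Collect_less continuous_intros)
  then show ?thesis
    using invariance_of_domain[OF holomorphic_on_imp_continuous_on[OF h(1)]] h(2)
    by (auto simp: bij_betw_def)
qed

lemma ring_domain_pole_notin:
  assumes "ring_domain n a \<alpha> U" "i \<in> {1..n}"
  shows "a i \<notin> U"
proof
  assume "a i \<in> U"
  then obtain T where T: "closed_trajectory n a \<alpha> T" "a i \<in> T"
    using assms(1) unfolding ring_domain_def by blast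
  then obtain \<gamma> where \<gamma>: "horizontal_curve n a \<alpha> \<gamma>" "T = \<gamma> ` {0<..<1}"
    by (auto simp: closed_trajectory_def trajectory_def)
  then obtain x where x: "x \<in> {0<..<1}" "a i = \<gamma> x" using T(2) by blast
  have "\<gamma> x \<notin> a ` {1..n}" using \<gamma>(1) x(1) by (simp add: horizontal_curve_def)
  then show False
    using x(2) assms(2) by (metis image_eqI)
qed

text \<open>The point \<open>q\<close> lies in a hole of \<open>U\<close>, but near \<open>\<Gamma>\<close> the set \<open>inside \<Gamma>\<close> meets \<open>U\<close>. Hence the connected
  set \<open>inside \<Gamma>\<close> crosses the boundary of the holes and so meets \<open>C\<close>, which,
  connected and disjoint from \<open>\<Gamma>\<close>, is trapped in \<open>inside \<Gamma>\<close>.\<close>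

lemma inside_subset_inside_of_separating:
  assumes U: "open U" "\<Gamma> \<subseteq> U"
    and conn: "connected (inside \<Gamma>)"
    and touch: "\<Gamma> \<inter> closure (inside \<Gamma>) \<noteq> {}"
    and q: "q \<in> inside \<Gamma>" "q \<notin> U"
    and C: "connected C" "C \<inter> \<Gamma> = {}" "frontier (inside U) \<subseteq> C"
  shows "inside C - \<Gamma> \<subseteq> inside \<Gamma>"
proof -
  have "outside U \<subseteq> outside \<Gamma>" using outside_mono[OF U(2)] .
  then have "q \<notin> outside U" using q(1) inside_Int_outside[of \<Gamma>] by blast
  then have qU: "q \<in> inside U" using q(2) inside_Un_outside[of U] by blast
  have "U \<inter> closure (inside \<Gamma>) \<noteq> {}" using touch U(2) by blast
  then have "U \<inter> inside \<Gamma> \<noteq> {}" using open_Int_closure_eq_empty[OF U(1)] by blast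
  then have "inside \<Gamma> - inside U \<noteq> {}" using inside_no_overlap[of U] by blast
  moreover have "inside \<Gamma> \<inter> inside U \<noteq> {}" using q(1) qU by blast
  ultimately have "inside \<Gamma> \<inter> frontier (inside U) \<noteq> {}"
    using connected_Int_frontier[OF conn] by blast
  then have "inside \<Gamma> \<inter> C \<noteq> {}" using C(3) by blast
  then have "outside \<Gamma> \<inter> C = {}"
    using inside_outside_intersect_connected[OF C(1)] C(2) by blast
  then have "C \<subseteq> inside \<Gamma>" using C(2) inside_Un_outside[of \<Gamma>] by blast
  then show ?thesis by (rule inside_inside)
qed

section \<open>The functional equation\<close>

lemma weighted_determinations_agree:
  fixes \<alpha> :: "'i \<Rightarrow> real" and L M :: "'i \<Rightarrow> real \<Rightarrow> complex"
  assumes "\<And>i. i \<in> I \<Longrightarrow> continuous_on UNIV (L i)" "\<And>i. i \<in> I \<Longrightarrow> continuous_on UNIV (M i)"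
    and "\<And>i t. i \<in> I \<Longrightarrow> exp (L i t) = exp (M i t)"
  shows "\<exists>\<kappa>::real. \<forall>t. (\<Sum>i\<in>I. of_real (\<alpha> i) * L i t) = (\<Sum>i\<in>I. of_real (\<alpha> i) * M i t) + \<i> * of_real \<kappa>"
proof -
  have "\<exists>\<kappa>::real. \<forall>t\<in>UNIV. L i t = M i t + \<i> * of_real \<kappa>" if "i \<in> I" for i
    using assms that by (intro continuous_logs_differ_by_constant) auto
  then obtain \<kappa> :: "'i \<Rightarrow> real" where "\<And>i t. i \<in> I \<Longrightarrow> L i t = M i t + \<i> * of_real (\<kappa> i)"
    by (metis UNIV_I)
  then have "(\<Sum>i\<in>I. of_real (\<alpha> i) * L i t) =
      (\<Sum>i\<in>I. of_real (\<alpha> i) * M i t) + \<i> * of_real (\<Sum>i\<in>I. \<alpha> i * \<kappa> i)" for t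
    by (simp add: sum.distrib sum_distrib_left algebra_simps)
  then show ?thesis by blast
qed

lemma blaschke_det_exists:
  assumes f: "continuous_on UNIV f" "\<And>t. norm (f t) = 1"
    and c: "\<And>i. i \<in> I \<Longrightarrow> norm (c i) \<noteq> 1"
  shows "\<exists>H. blaschke_det I \<beta> c f H"
proof -
  have "\<exists>h. power_det (\<beta> i) (\<lambda>t. blaschke_factor (c i) (f t)) h" if "i \<in> I" for i
    using blaschke_factor_curve[OF f c[OF that]] by (intro power_det_exists)
  then obtain h where "\<And>i. i \<in> I \<Longrightarrow> power_det (\<beta> i) (\<lambda>t. blaschke_factor (c i) (f t)) (h i)"
    by metis
  then show ?thesis unfolding blaschke_det_def by blast
qed

lemma blaschke_det_log:
  assumes "blaschke_det I \<beta> c f H" "finite I"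
  obtains l where "\<And>i. i \<in> I \<Longrightarrow> continuous_on UNIV (l i)"
    "\<And>i t. i \<in> I \<Longrightarrow> exp (l i t) = blaschke_factor (c i) (f t)"
    "\<And>t. H t = exp (\<Sum>i\<in>I. of_real (\<beta> i) * l i t)"
proof -
  obtain h where h: "\<And>i. i \<in> I \<Longrightarrow> power_det (\<beta> i) (\<lambda>t. blaschke_factor (c i) (f t)) (h i)"
    "H = (\<lambda>t. \<Prod>i\<in>I. h i t)"
    using assms unfolding blaschke_det_def by blast
  obtain l where l: "\<And>i. i \<in> I \<Longrightarrow> continuous_on UNIV (l i)"
    "\<And>i t. i \<in> I \<Longrightarrow> exp (l i t) = blaschke_factor (c i) (f t)"
    "\<And>i t. i \<in> I \<Longrightarrow> h i t = exp (of_real (\<beta> i) * l i t)"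
    using h(1) unfolding power_det_def by metis
  show thesis
    by (rule that[of l]) (use l h(2) assms(2) in \<open>auto simp: exp_sum\<close>)
qed

text \<open>Both halves compute logarithms of the same function \<open>\<phi>m (cis t) - a i\<close>, which equals \<open>\<phi>p (k t) - a i\<close>:
  \<open>P i\<close> from the interior side and \<open>N i\<close> from the exterior side. Their weighted sums therefore differ by an
  imaginary constant, and up to imaginary constants they are the logarithms of \<open>G\<close> and \<open>F\<close>.\<close>

lemma fingerprint_equation:
  fixes k :: "real \<Rightarrow> complex"
  assumes maps: "interior_map \<Gamma> \<phi>m" "exterior_map \<Gamma> \<phi>p"
    and lem: "\<Gamma> \<subseteq> lemniscate n a \<alpha> 1"
    and pin: "\<And>i. i \<in> {1..s} \<Longrightarrow> a i \<in> inside \<Gamma>"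
    and pout: "\<And>i. i \<in> {s+1..n} \<Longrightarrow> a i \<in> outside \<Gamma>" and sn: "s \<le> n"
    and k: "continuous_on UNIV k" "\<And>t. norm (k t) = 1" "\<And>t. \<phi>p (k t) = \<phi>m (cis t)"
    and F: "B_det n s a \<alpha> \<phi>p k F" and G: "A_det s a \<alpha> \<phi>m cis G"
  shows "\<exists>\<theta>::real. \<forall>t. F t = cis \<theta> * G t"
proof -
  note tm = interior_map_topology[OF maps(1)]
  note tp = exterior_map_topology[OF maps(2)]
  have \<phi>m: "\<phi>m w \<in> lemniscate n a \<alpha> 1" if "norm w = 1" for w
    using interior_map_circle[OF maps(1) tp(6) that] lem by blast
  have \<phi>p: "\<phi>p w \<in> lemniscate n a \<alpha> 1" if "norm w = 1" for w
    using exterior_map_circle[OF maps(2) tm(6) that] lem by blast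
  obtain L \<theta>1 where L: "\<And>i. i \<in> {1..n} \<Longrightarrow> continuous_on (cball 0 1) (L i)"
    "\<And>i w. i \<in> {1..n} \<Longrightarrow> w \<in> cball 0 1 \<Longrightarrow> \<phi>m w - a i =
       (if a i \<in> inside \<Gamma> then blaschke_factor (int_inv \<phi>m (a i)) w else 1) * exp (L i w)"
    "\<And>w. w \<in> cball 0 1 \<Longrightarrow> (\<Sum>i=1..n. of_real (\<alpha> i) * L i w) = \<i> * of_real \<theta>1"
    by (rule interior_logs_with_constant_sum[OF maps(1) \<phi>m], assumption, rule that)
  obtain M \<theta>2 where M: "\<And>i. i \<in> {1..n} \<Longrightarrow> continuous_on (cball 0 1) (M i)"
    "\<And>i z. i \<in> {1..n} \<Longrightarrow> norm z = 1 \<Longrightarrow> \<phi>p z - a i =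
       z * (if a i \<in> outside \<Gamma> then blaschke_factor (ext_inv \<phi>p (a i)) z else 1) * exp (M i (1 / z))"
    "\<And>w. w \<in> cball 0 1 \<Longrightarrow> (\<Sum>i=1..n. of_real (\<alpha> i) * M i w) = \<i> * of_real \<theta>2"
    by (rule exterior_logs_with_constant_sum[OF maps(2) \<phi>p], assumption, rule that)
  obtain l where l: "\<And>i. i \<in> {1..s} \<Longrightarrow> continuous_on UNIV (l i)"
    "\<And>i t. i \<in> {1..s} \<Longrightarrow> exp (l i t) = blaschke_factor (int_inv \<phi>m (a i)) (cis t)"
    "\<And>t. G t = exp (\<Sum>i\<in>{1..s}. of_real (\<alpha> i) * l i t)"
    using blaschke_det_log[OF G[unfolded A_det_def]] by auto
  obtain h0 h where h: "power_det (\<Sum>i=1..n. \<alpha> i) k h0"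
    "blaschke_det {s+1..n} \<alpha> (\<lambda>i. ext_inv \<phi>p (a i)) k h" "F = (\<lambda>t. h0 t * h t)"
    using F unfolding B_det_def by blast
  obtain m0 where m0: "continuous_on UNIV m0" "\<And>t. exp (m0 t) = k t"
    "\<And>t. h0 t = exp (of_real (\<Sum>i=1..n. \<alpha> i) * m0 t)"
    using h(1) unfolding power_det_def by blast
  obtain m where m: "\<And>i. i \<in> {s+1..n} \<Longrightarrow> continuous_on UNIV (m i)"
    "\<And>i t. i \<in> {s+1..n} \<Longrightarrow> exp (m i t) = blaschke_factor (ext_inv \<phi>p (a i)) (k t)"
    "\<And>t. h t = exp (\<Sum>i\<in>{s+1..n}. of_real (\<alpha> i) * m i t)"
    using blaschke_det_log[OF h(2)] by auto
  define P where "P i t = L i (cis t) + (if i \<le> s then l i t else 0)" for i t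
  define N where "N i t = M i (1 / k t) + m0 t + (if i \<le> s then 0 else m i t)" for i t
  have k0: "k t \<noteq> 0" for t using k(2)[of t] by auto
  have Pc: "continuous_on UNIV (P i)" if i: "i \<in> {1..n}" for i
  proof -
    have "continuous_on UNIV (\<lambda>t. L i (cis t))"
      by (rule continuous_on_compose2[OF L(1)[OF i]]) (auto intro!: continuous_intros)
    then show ?thesis
      unfolding P_def using l(1)[of i] i by (cases "i \<le> s") (auto intro!: continuous_intros)
  qed
  have Nc: "continuous_on UNIV (N i)" if i: "i \<in> {1..n}" for i
  proof -
    have "continuous_on UNIV (\<lambda>t. M i (1 / k t))"
      by (rule continuous_on_compose2[OF M(1)[OF i]])
        (use k k0 in \<open>auto intro!: continuous_intros simp: norm_divide\<close>)
    then show ?thesis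
      unfolding N_def using m(1)[of i] i m0(1) by (cases "i \<le> s") (auto intro!: continuous_intros)
  qed
  have Pe: "exp (P i t) = \<phi>m (cis t) - a i" if i: "i \<in> {1..n}" for i t
  proof (cases "i \<le> s")
    case True
    then show ?thesis
      using L(2)[OF i, of "cis t"] l(2)[of i t] pin[of i] i by (simp add: P_def exp_add)
  next
    case False
    then have "a i \<notin> inside \<Gamma>"
      using pout[of i] i inside_Int_outside[of \<Gamma>] by (auto simp del: inside_Int_outside)
    then show ?thesis
      using False L(2)[OF i, of "cis t"] by (simp add: P_def)
  qed
  have Ne: "exp (N i t) = \<phi>p (k t) - a i" if i: "i \<in> {1..n}" for i t
  proof (cases "i \<le> s")
    case False
    then show ?thesis
      using M(2)[OF i k(2), of t] m(2)[of i t] pout[of i] i by (simp add: N_def exp_add m0)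
  next
    case True
    then have "a i \<notin> outside \<Gamma>"
      using pin[of i] i inside_Int_outside[of \<Gamma>] by (auto simp del: inside_Int_outside)
    then show ?thesis
      using True M(2)[OF i k(2), of t] by (simp add: N_def exp_add m0)
  qed
  obtain \<kappa> :: real where \<kappa>: "\<And>t. (\<Sum>i\<in>{1..n}. of_real (\<alpha> i) * N i t) =
      (\<Sum>i\<in>{1..n}. of_real (\<alpha> i) * P i t) + \<i> * of_real \<kappa>"
    using weighted_determinations_agree[of "{1..n}" N P \<alpha>] Pc Nc Pe Ne k(3) by auto
  have G': "exp (\<Sum>i\<in>{1..n}. of_real (\<alpha> i) * P i t) = cis \<theta>1 * G t" for t
  proof -
    have "(\<Sum>i\<in>{1..n}. of_real (\<alpha> i) * P i t) = \<i> * of_real \<theta>1 +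
        (\<Sum>i\<in>{1..n}. of_real (\<alpha> i) * (if i \<le> s then l i t else 0))"
      using L(3)[of "cis t"] by (simp add: P_def algebra_simps sum.distrib)
    also have "(\<Sum>i\<in>{1..n}. of_real (\<alpha> i) * (if i \<le> s then l i t else 0)) =
        (\<Sum>i\<in>{1..s}. of_real (\<alpha> i) * l i t)"
      using sn by (intro sum.mono_neutral_cong_right) auto
    finally show ?thesis by (simp add: exp_add l(3) cis_conv_exp)
  qed
  have F': "exp (\<Sum>i\<in>{1..n}. of_real (\<alpha> i) * N i t) = cis \<theta>2 * F t" for t
  proof -
    have "(\<Sum>i\<in>{1..n}. of_real (\<alpha> i) * N i t) = \<i> * of_real \<theta>2 + of_real (\<Sum>i=1..n. \<alpha> i) * m0 t +
        (\<Sum>i\<in>{1..n}. of_real (\<alpha> i) * (if i \<le> s then 0 else m i t))"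
      using M(3)[of "1 / k t"] k(2)[of t]
      by (simp add: N_def algebra_simps sum.distrib norm_divide sum_distrib_left)
    also have "(\<Sum>i\<in>{1..n}. of_real (\<alpha> i) * (if i \<le> s then 0 else m i t)) =
        (\<Sum>i\<in>{s+1..n}. of_real (\<alpha> i) * m i t)"
      by (intro sum.mono_neutral_cong_right) auto
    finally show ?thesis by (simp add: exp_add m(3) m0(3) h(3) cis_conv_exp)
  qed
  have "F t = cis (\<theta>1 + \<kappa> - \<theta>2) * G t" for t
  proof -
    have "cis \<theta>2 * F t = cis \<theta>1 * G t * cis \<kappa>"
      unfolding F'[symmetric] \<kappa> by (simp only: exp_add G' cis_conv_exp)
    then have "cis (- \<theta>2) * (cis \<theta>2 * F t) = cis (- \<theta>2) * (cis \<theta>1 * G t * cis \<kappa>)" by simp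
    then have "(cis (- \<theta>2) * cis \<theta>2) * F t = (cis \<theta>1 * cis \<kappa> * cis (- \<theta>2)) * G t"
      by (simp only: mult_ac)
    then show ?thesis by (simp add: cis_mult)
  qed
  then show ?thesis by blast
qed

theorem theorem5:
  fixes n s \<mu> \<nu> :: nat
    and a :: "nat \<Rightarrow> complex" and \<alpha> :: "nat \<Rightarrow> real"
    and p :: "complex poly"
    and U \<Gamma>r \<Gamma>R \<Gamma>1 :: "complex set"
    and r R :: real
    and \<phi>m \<phi>p k :: "complex \<Rightarrow> complex"
    and za zb :: complex
  assumes distinct: "inj_on a {1..n}"
    and nonzero: "\<And>i. i \<in> {1..n} \<Longrightarrow> \<alpha> i \<noteq> 0"
    and total: "(\<Sum>i=1..n. \<alpha> i) > 0"
    and p: "\<And>z. z \<notin> a ` {1..n} \<Longrightarrow>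
              (\<Sum>i=1..n. of_real (\<alpha> i) / (z - a i)) = poly p z / (\<Prod>i=1..n. z - a i)"
    and ring: "ring_domain n a \<alpha> U"
    and levels: "0 < r" "r < 1" "1 < R"
    and sub_r: "sub_lemniscate n a \<alpha> r \<Gamma>r"
    and sub_R: "sub_lemniscate n a \<alpha> R \<Gamma>R"
    and bounded: "bounded_by U \<Gamma>r \<Gamma>R"
    and s: "1 < s" "s < n"
    and inner: "\<And>i. i \<in> {1..s} \<Longrightarrow> a i \<in> inside \<Gamma>r"
    and outer: "\<And>i. i \<in> {s+1..n} \<Longrightarrow> a i \<in> outside U"
    and sub_1: "sub_lemniscate n a \<alpha> 1 \<Gamma>1" "\<Gamma>1 \<subseteq> U"
    and maps: "interior_map \<Gamma>1 \<phi>m" "exterior_map \<Gamma>1 \<phi>p"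
    and zeros: "{z \<in> inside \<Gamma>1. poly p z = 0} = {za, zb}" "za \<noteq> zb"
    and mult: "order za p = \<mu>" "order zb p = \<nu>"
    and k: "\<And>z. norm z = 1 \<Longrightarrow> k z = fingerprint \<phi>m \<phi>p z"
  shows "(\<forall>z. norm z = 1 \<longrightarrow> norm (k z) = 1) \<and>
         (\<exists>F. B_det n s a \<alpha> \<phi>p (\<lambda>t. k (cis t)) F) \<and>
         (\<exists>G. A_det s a \<alpha> \<phi>m cis G) \<and>
         (\<forall>F G. B_det n s a \<alpha> \<phi>p (\<lambda>t. k (cis t)) F \<and> A_det s a \<alpha> \<phi>m cis G \<longrightarrow>
            (\<exists>\<theta>::real. \<forall>t. F t = cis \<theta> * G t))"
proof -
  note tm = interior_map_topology[OF maps(1)]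
  note tp = exterior_map_topology[OF maps(2)]
  have lem: "\<Gamma>1 \<subseteq> lemniscate n a \<alpha> 1" "\<Gamma>r \<subseteq> lemniscate n a \<alpha> r" and conn_r: "connected \<Gamma>r"
    using sub_1(1) sub_r in_components_subset in_components_connected
    unfolding sub_lemniscate_def by blast+
  \<comment> \<open>Otherwise all points of the open set \<open>inside \<Gamma>1\<close> would be zeros of \<open>p\<close>.\<close>
  have "p \<noteq> 0"
  proof
    assume "p = 0"
    then have "inside \<Gamma>1 = {za, zb}" using zeros(1) by simp
    then show False using tm(8) by simp
  qed
  then have thin: "interior (lemniscate n a \<alpha> 1) = {}"
    by (intro interior_lemniscate_empty[OF p]) auto
  then have thin1: "interior \<Gamma>1 = {}" using lem(1) interior_mono by blast

  have \<phi>m_circle: "\<phi>m w \<in> \<Gamma>1" if "norm w = 1" for w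
    using interior_map_circle[OF maps(1) tp(6) that] .
  then obtain j where j: "j \<in> {1..n}" "a j \<in> inside \<Gamma>1"
    using inside_contains_pole[OF maps(1) _ thin] lem(1) by blast
  have "lemniscate n a \<alpha> r \<inter> lemniscate n a \<alpha> 1 = {}"
    using levels by (auto simp: lemniscate_def)
  then have disj: "\<Gamma>r \<inter> \<Gamma>1 = {}" using lem by blast
  \<comment> \<open>A priori \<open>\<Gamma>r\<close> could lie outside \<open>\<Gamma>1\<close>; the pole \<open>a j\<close> in a hole of \<open>U\<close> within \<open>\<Gamma>1\<close> excludes this.\<close>
  have "inside \<Gamma>r - \<Gamma>1 \<subseteq> inside \<Gamma>1"
  proof (rule inside_subset_inside_of_separating)
    show "\<Gamma>1 \<inter> closure (inside \<Gamma>1) \<noteq> {}"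
      using \<phi>m_circle[of 1] tm(4) by force
    show "\<Gamma>r \<inter> \<Gamma>1 = {}" by (rule disj)
  qed (use ring_domain_open[OF ring] sub_1(2) tm(7) j ring_domain_pole_notin[OF ring j(1)]
      conn_r bounded in \<open>auto simp: bounded_by_def\<close>)
  moreover have "a i \<notin> \<Gamma>1" if "i \<in> {1..s}" for i
    using lemniscate_pole_notin[of i n 1 a \<alpha>] that s lem(1) by auto
  ultimately have pin: "a i \<in> inside \<Gamma>1" if "i \<in> {1..s}" for i
    using inner that by blast
  have pout: "a i \<in> outside \<Gamma>1" if "i \<in> {s+1..n}" for i
    using outer[OF that] outside_mono[OF sub_1(2)] by blast

  have k_norm: "norm (k z) = 1" and k_map: "\<phi>p (k z) = \<phi>m z" if "norm z = 1" for z
    using fingerprint_circle[OF maps that thin1] k[OF that] by auto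
  have k_cont: "continuous_on UNIV (\<lambda>t. k (cis t))"
    using continuous_on_fingerprint_cis[OF maps thin1] by (simp add: k)
  have "norm (int_inv \<phi>m (a i)) \<noteq> 1" if "i \<in> {1..s}" for i
    using norm_int_inv_less_1[OF maps(1) pin[OF that]] by simp
  then have exG: "\<exists>G. A_det s a \<alpha> \<phi>m cis G"
    unfolding A_det_def by (intro blaschke_det_exists) (auto intro!: continuous_intros)
  have "norm (ext_inv \<phi>p (a i)) \<noteq> 1" if "i \<in> {s+1..n}" for i
    using norm_ext_inv_greater_1[OF maps(2) pout[OF that]] by simp
  then obtain h where h: "blaschke_det {s+1..n} \<alpha> (\<lambda>i. ext_inv \<phi>p (a i)) (\<lambda>t. k (cis t)) h"
    using blaschke_det_exists[OF k_cont, of "{s+1..n}" "\<lambda>i. ext_inv \<phi>p (a i)" \<alpha>] k_norm by auto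
  have "k (cis t) \<noteq> 0" for t using k_norm[of "cis t"] by auto
  then obtain h0 where "power_det (\<Sum>i=1..n. \<alpha> i) (\<lambda>t. k (cis t)) h0"
    using power_det_exists[OF k_cont] by blast
  with h have exF: "\<exists>F. B_det n s a \<alpha> \<phi>p (\<lambda>t. k (cis t)) F"
    unfolding B_det_def by blast
  have "\<exists>\<theta>::real. \<forall>t. F t = cis \<theta> * G t"
    if "B_det n s a \<alpha> \<phi>p (\<lambda>t. k (cis t)) F" "A_det s a \<alpha> \<phi>m cis G" for F G
    by (rule fingerprint_equation[OF maps lem(1) pin pout _ k_cont _ _ that])
      (use k_norm k_map s in auto)
  then show ?thesis using k_norm exF exG by blast
qed

end
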